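(* Let $n\leq 5$ be a positive integer, let $N$ be the number of edges of the complete graph $K_n$, and let $\mathbb{K}$ be a field of characteristic zero. Then the algebra $A_{M(K_{n})}=\mathbb{K}[x_1,\ldots,x_N]/\mathrm{Ann}(F_{K_n})$ has the strong Lefschetz property, and $x_{1}+\cdots+x_{N}$ is a strong Lefschetz element.
   Context: For a connected graph $\Gamma$ with $N$ edges labelled $1,\dots,N$, assign the variable $x_e$ to edge $e$; the Kirchhoff polynomial is $F_\Gamma=\sum_{T}\prod_{e\in E(T)}x_e$, the sum over spanning trees $T$ of $\Gamma$. For a homogeneous $F\in\mathbb{K}[x_1,\ldots,x_N]$, $\mathrm{Ann}(F)=\{P\in\mathbb{K}[x_1,\ldots,x_N]: P(\partial/\partial x_1,\ldots,\partial/\partial x_N)F=0\}$, a homogeneous ideal; $A_{M(\Gamma)}=\mathbb{K}[x_1,\ldots,x_N]/\mathrm{Ann}(F_\Gamma)$ is a graded Artinian Gorenstein algebra. A graded Artinian algebra $A=\bigoplus_{k=0}^sA_k$ with $A_s\neq 0$ has the strong Lefschetz property if there is $L\in A_1$ such that multiplication by $L^{s-2k}$ is a bijection $A_k\to A_{s-k}$ for all $k\leq s/2$; such an $L$ is a strong Lefschetz element. *)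

theory Defs
  imports "HOL-Algebra.QuotRing" "HOL-Library.Poly_Mapping"
begin

section \<open>Polynomials in finitely many variables\<close>

text \<open>
  A monomial is its exponent vector (a finitely supported function on variable indices), and a
  polynomial is a finitely supported family of coefficients. The multiplication of the type is
  convolution, i.e. multiplication of polynomials. The variables are indexed by all natural
  numbers; the ring in the variables with index 1 to \<open>N\<close> is cut out by its carrier.
\<close>

type_synonym monom = "nat \<Rightarrow>\<^sub>0 nat"
type_synonym 'k mpoly = "monom \<Rightarrow>\<^sub>0 'k"

definition var :: "nat \<Rightarrow> 'k::field_char_0 mpoly" where
  "var i = Poly_Mapping.single (Poly_Mapping.single i 1) 1"

definition const :: "'k \<Rightarrow> 'k::field_char_0 mpoly" where
  "const c = Poly_Mapping.single 0 c"

definition poly_ring :: "nat \<Rightarrow> 'k::field_char_0 mpoly ring" where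
  "poly_ring N =
    \<lparr>carrier = {p. \<forall>m \<in> Poly_Mapping.keys p. Poly_Mapping.keys m \<subseteq> {1..N}},
     mult = (*), one = 1, zero = 0, add = (+)\<rparr>"

definition mdeg :: "monom \<Rightarrow> nat" where
  "mdeg m = (\<Sum>i \<in> Poly_Mapping.keys m. Poly_Mapping.lookup m i)"

definition homogeneous_part :: "nat \<Rightarrow> nat \<Rightarrow> 'k::field_char_0 mpoly set" where
  "homogeneous_part N k =
    {p \<in> carrier (poly_ring N). \<forall>m \<in> Poly_Mapping.keys p. mdeg m = k}"


section \<open>The annihilator of a form and its graded quotient algebra\<close>

definition pdiff :: "nat \<Rightarrow> 'k::field_char_0 mpoly \<Rightarrow> 'k mpoly" where
  "pdiff i p = (\<Sum>m \<in> Poly_Mapping.keys p.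
     Poly_Mapping.single (m - Poly_Mapping.single i 1)
       (of_nat (Poly_Mapping.lookup m i) * Poly_Mapping.lookup p m))"

text \<open>
  The partial derivatives commute, so the order of composition does not matter; the indices of the
  variables of \<open>m\<close> are taken in increasing order only to have a definite term.
\<close>

definition mon_diff :: "monom \<Rightarrow> 'k::field_char_0 mpoly \<Rightarrow> 'k mpoly" where
  "mon_diff m =
    foldr (\<lambda>i. pdiff i ^^ Poly_Mapping.lookup m i) (sorted_list_of_set (Poly_Mapping.keys m))"

definition diff_op :: "'k::field_char_0 mpoly \<Rightarrow> 'k mpoly \<Rightarrow> 'k mpoly" where
  "diff_op P F =
    (\<Sum>m \<in> Poly_Mapping.keys P. const (Poly_Mapping.lookup P m) * mon_diff m F)"

definition Ann :: "nat \<Rightarrow> 'k::field_char_0 mpoly \<Rightarrow> 'k mpoly set" where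
  "Ann N F = {P \<in> carrier (poly_ring N). diff_op P F = 0}"

definition quot_class :: "nat \<Rightarrow> 'k::field_char_0 mpoly \<Rightarrow> 'k mpoly \<Rightarrow> 'k mpoly set" where
  "quot_class N F p = Ann N F +>\<^bsub>poly_ring N\<^esub> p"

definition quot_alg :: "nat \<Rightarrow> 'k::field_char_0 mpoly \<Rightarrow> 'k mpoly set ring" where
  "quot_alg N F = poly_ring N Quot Ann N F"

definition quot_part :: "nat \<Rightarrow> 'k::field_char_0 mpoly \<Rightarrow> nat \<Rightarrow> 'k mpoly set set" where
  "quot_part N F k = quot_class N F ` homogeneous_part N k"


section \<open>The strong Lefschetz property\<close>

text \<open>
  Here \<open>gr k\<close> is the component of degree \<open>k\<close> of the graded algebra \<open>A\<close>. The number \<open>s\<close>, the largest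
  degree with a nonzero component, is determined by the first two conjuncts under the quantifier.
\<close>

definition strong_Lefschetz_element ::
    "('a, 'b) ring_scheme \<Rightarrow> (nat \<Rightarrow> 'a set) \<Rightarrow> 'a \<Rightarrow> bool" where
  "strong_Lefschetz_element A gr L \<longleftrightarrow>
    L \<in> gr 1 \<and>
    (\<exists>s. gr s \<noteq> {\<zero>\<^bsub>A\<^esub>} \<and> (\<forall>k>s. gr k = {\<zero>\<^bsub>A\<^esub>}) \<and>
      (\<forall>k. 2 * k \<le> s \<longrightarrow>
        bij_betw (\<lambda>a. (L [^]\<^bsub>A\<^esub> (s - 2 * k)) \<otimes>\<^bsub>A\<^esub> a) (gr k) (gr (s - k))))"

definition strong_Lefschetz_property ::
    "('a, 'b) ring_scheme \<Rightarrow> (nat \<Rightarrow> 'a set) \<Rightarrow> bool" where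
  "strong_Lefschetz_property A gr \<longleftrightarrow> (\<exists>L. strong_Lefschetz_element A gr L)"


section \<open>Graphs, spanning trees and the Kirchhoff polynomial\<close>

text \<open>A simple graph is a set \<open>V\<close> of vertices with a set \<open>E\<close> of two-element subsets of \<open>V\<close>.\<close>

definition connected_graph :: "'v set \<Rightarrow> 'v set set \<Rightarrow> bool" where
  "connected_graph V E \<longleftrightarrow>
    V \<noteq> {} \<and> (\<forall>u\<in>V. \<forall>v\<in>V. (u, v) \<in> {(a, b). {a, b} \<in> E}\<^sup>*)"

definition is_cycle :: "'v set set \<Rightarrow> 'v list \<Rightarrow> bool" where
  "is_cycle E c \<longleftrightarrow> 3 \<le> length c \<and> distinct c \<and>
    (\<forall>i < length c. {c ! i, c ! (Suc i mod length c)} \<in> E)"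

definition is_tree :: "'v set \<Rightarrow> 'v set set \<Rightarrow> bool" where
  "is_tree V E \<longleftrightarrow> connected_graph V E \<and> \<not> (\<exists>c. is_cycle E c)"

definition spanning_trees :: "'v set \<Rightarrow> 'v set set \<Rightarrow> 'v set set set" where
  "spanning_trees V E = {T. T \<subseteq> E \<and> is_tree V T}"

text \<open>The edge \<open>e\<close> carries the label \<open>lab e\<close>, and its variable is the one with that index.\<close>

definition Kirchhoff_poly ::
    "'v set \<Rightarrow> 'v set set \<Rightarrow> ('v set \<Rightarrow> nat) \<Rightarrow> 'k::field_char_0 mpoly" where
  "Kirchhoff_poly V E lab = (\<Sum>T \<in> spanning_trees V E. \<Prod>e\<in>T. var (lab e))"

definition complete_edges :: "nat \<Rightarrow> nat set set" where
  "complete_edges n = {e. e \<subseteq> {1..n} \<and> card e = 2}"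


section \<open>The annihilator is an ideal\<close>

lemma lookup_pdiff:
  "Poly_Mapping.lookup (pdiff i p) a =
    of_nat (Suc (Poly_Mapping.lookup a i)) * Poly_Mapping.lookup p (a + Poly_Mapping.single i 1)"
proof -
  have *: "of_nat (Poly_Mapping.lookup m i) * Poly_Mapping.lookup p m *
        (1 when m - Poly_Mapping.single i 1 = a) =
      (if m = a + Poly_Mapping.single i 1
       then of_nat (Suc (Poly_Mapping.lookup a i)) * Poly_Mapping.lookup p (a + Poly_Mapping.single i 1)
       else 0)" for m
  proof (cases "Poly_Mapping.lookup m i = 0")
    case True
    then have "m \<noteq> a + Poly_Mapping.single i 1"
      by (auto simp: lookup_add)
    with True show ?thesis by simp
  next
    case False
    then have "m - Poly_Mapping.single i 1 + Poly_Mapping.single i 1 = m"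
      by (intro poly_mapping_eqI) (auto simp: lookup_add lookup_minus lookup_single when_def)
    then have "m - Poly_Mapping.single i 1 = a \<longleftrightarrow> m = a + Poly_Mapping.single i 1"
      by (metis add_diff_cancel_right')
    then show ?thesis by (auto simp: lookup_add)
  qed
  have "Poly_Mapping.lookup (pdiff i p) a =
     (\<Sum>m \<in> Poly_Mapping.keys p. of_nat (Poly_Mapping.lookup m i) * Poly_Mapping.lookup p m *
        (1 when m - Poly_Mapping.single i 1 = a))"
    unfolding pdiff_def lookup_sum lookup_single by (intro sum.cong) (auto simp: when_def)
  also have "\<dots> = of_nat (Suc (Poly_Mapping.lookup a i)) * Poly_Mapping.lookup p (a + Poly_Mapping.single i 1)"
    unfolding * by (simp add: in_keys_iff)
  finally show ?thesis .
qed

lemma lookup_pdiff_power: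
  "Poly_Mapping.lookup ((pdiff i ^^ k) p) a =
    pochhammer (of_nat (Suc (Poly_Mapping.lookup a i))) k
      * Poly_Mapping.lookup p (a + Poly_Mapping.single i k)"
proof (induction k arbitrary: a)
  case (Suc k)
  have "a + Poly_Mapping.single i 1 + Poly_Mapping.single i k = a + Poly_Mapping.single i (Suc k)"
    by (simp add: add.assoc single_add[symmetric])
  then show ?case
    by (simp add: lookup_pdiff Suc.IH pochhammer_rec lookup_add add_ac mult.assoc)
qed simp

lemma lookup_foldr_pdiff:
  assumes "distinct xs"
  shows "Poly_Mapping.lookup (foldr (\<lambda>i. pdiff i ^^ f i) xs p) a =
    (\<Prod>i\<in>set xs. pochhammer (of_nat (Suc (Poly_Mapping.lookup a i))) (f i))
      * Poly_Mapping.lookup p (a + (\<Sum>i\<in>set xs. Poly_Mapping.single i (f i)))"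
  using assms
proof (induction xs arbitrary: a)
  case (Cons x xs)
  have "(\<Prod>i\<in>set xs. pochhammer (of_nat (Suc (Poly_Mapping.lookup (a + Poly_Mapping.single x (f x)) i))) (f i))
     = (\<Prod>i\<in>set xs. pochhammer (of_nat (Suc (Poly_Mapping.lookup a i)) :: 'a) (f i))"
    using Cons.prems by (intro prod.cong) (auto simp: lookup_add lookup_single when_def)
  with Cons show ?case
    by (simp add: lookup_pdiff_power add.assoc mult.assoc)
qed simp

lemma monom_eq_sum_single:
  fixes m :: monom
  assumes "finite S" "Poly_Mapping.keys m \<subseteq> S"
  shows "(\<Sum>i\<in>S. Poly_Mapping.single i (Poly_Mapping.lookup m i)) = m"
  using assms
  by (intro poly_mapping_eqI) (auto simp: lookup_sum lookup_single when_def in_keys_iff)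

lemma lookup_mon_diff:
  assumes "finite S" "Poly_Mapping.keys m \<subseteq> S"
  shows "Poly_Mapping.lookup (mon_diff m p) a =
    (\<Prod>i\<in>S. pochhammer (of_nat (Suc (Poly_Mapping.lookup a i))) (Poly_Mapping.lookup m i))
      * Poly_Mapping.lookup p (a + m)"
proof -
  have "(\<Prod>i\<in>S. pochhammer (of_nat (Suc (Poly_Mapping.lookup a i)) :: 'a) (Poly_Mapping.lookup m i)) =
    (\<Prod>i\<in>Poly_Mapping.keys m. pochhammer (of_nat (Suc (Poly_Mapping.lookup a i))) (Poly_Mapping.lookup m i))"
    using assms by (intro prod.mono_neutral_right) (auto simp: in_keys_iff)
  then show ?thesis
    by (simp add: mon_diff_def lookup_foldr_pdiff monom_eq_sum_single)
qed

lemma mon_diff_add: "mon_diff (m + m') p = mon_diff m (mon_diff m' p)"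
proof (rule poly_mapping_eqI)
  fix a
  let ?S = "Poly_Mapping.keys m \<union> Poly_Mapping.keys m'"
  have S: "finite ?S" "Poly_Mapping.keys m \<subseteq> ?S" "Poly_Mapping.keys m' \<subseteq> ?S"
    "Poly_Mapping.keys (m + m') \<subseteq> ?S"
    using Poly_Mapping.keys_add[of m m'] by auto
  show "Poly_Mapping.lookup (mon_diff (m + m') p) a = Poly_Mapping.lookup (mon_diff m (mon_diff m' p)) a"
    unfolding lookup_mon_diff[OF S(1,2)] lookup_mon_diff[OF S(1,3)] lookup_mon_diff[OF S(1,4)]
    by (simp add: lookup_add pochhammer_product' prod.distrib add_ac mult_ac)
qed

lemma lookup_const_mult: "Poly_Mapping.lookup (const c * p) a = c * Poly_Mapping.lookup p a"
  by (simp add: const_def flip: mult_map_scale_conv_mult)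
    (simp add: map.rep_eq when_def)

lemma mon_diff_sum: "mon_diff m (\<Sum>x\<in>X. f x) = (\<Sum>x\<in>X. mon_diff m (f x))"
  by (rule poly_mapping_eqI)
    (simp add: lookup_mon_diff[OF finite_keys order_refl] lookup_sum sum_distrib_left)

lemma mon_diff_const_mult: "mon_diff m (const c * p) = const c * mon_diff m p"
  by (rule poly_mapping_eqI)
    (simp add: lookup_mon_diff[OF finite_keys order_refl] lookup_const_mult mult.left_commute)

lemma diff_op_superset:
  assumes "finite S" "Poly_Mapping.keys P \<subseteq> S"
  shows "diff_op P F = (\<Sum>m\<in>S. const (Poly_Mapping.lookup P m) * mon_diff m F)"
  unfolding diff_op_def using assms
  by (intro sum.mono_neutral_left) (auto simp: in_keys_iff const_def)

lemma const_mult: "const (c * d) = const c * const d"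
  by (simp add: const_def mult_single)

lemma diff_op_add: "diff_op (P + Q) F = diff_op P F + diff_op Q F"
proof -
  let ?S = "Poly_Mapping.keys P \<union> Poly_Mapping.keys Q"
  have S: "finite ?S" "Poly_Mapping.keys P \<subseteq> ?S" "Poly_Mapping.keys Q \<subseteq> ?S"
    "Poly_Mapping.keys (P + Q) \<subseteq> ?S"
    using Poly_Mapping.keys_add[of P Q] by auto
  show ?thesis
    unfolding diff_op_superset[OF S(1,2)] diff_op_superset[OF S(1,3)] diff_op_superset[OF S(1,4)]
    by (simp add: lookup_add const_def single_add algebra_simps sum.distrib)
qed

lemma diff_op_zero [simp]: "diff_op 0 F = 0"
  by (simp add: diff_op_def)

lemma diff_op_sum: "diff_op (\<Sum>x\<in>X. f x) F = (\<Sum>x\<in>X. diff_op (f x) F)"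
  by (induction X rule: infinite_finite_induct) (auto simp: diff_op_add)

lemma diff_op_single: "diff_op (Poly_Mapping.single m c) F = const c * mon_diff m F"
  by (simp add: diff_op_def const_def)

lemma poly_eq_sum_single:
  fixes P :: "'k::field_char_0 mpoly"
  shows "(\<Sum>m\<in>Poly_Mapping.keys P. Poly_Mapping.single m (Poly_Mapping.lookup P m)) = P"
  by (intro poly_mapping_eqI) (auto simp: lookup_sum lookup_single when_def in_keys_iff)

lemma diff_op_mult: "diff_op (P * Q) F = diff_op P (diff_op Q F)"
proof -
  have "diff_op (P * Q) F = diff_op
     ((\<Sum>m\<in>Poly_Mapping.keys P. Poly_Mapping.single m (Poly_Mapping.lookup P m)) *
      (\<Sum>m\<in>Poly_Mapping.keys Q. Poly_Mapping.single m (Poly_Mapping.lookup Q m))) F"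
    by (simp add: poly_eq_sum_single)
  also have "\<dots> = (\<Sum>m\<in>Poly_Mapping.keys P. \<Sum>m'\<in>Poly_Mapping.keys Q.
      const (Poly_Mapping.lookup P m * Poly_Mapping.lookup Q m') * mon_diff (m + m') F)"
    by (simp add: sum_product diff_op_sum diff_op_single mult_single)
  also have "\<dots> = (\<Sum>m\<in>Poly_Mapping.keys P. const (Poly_Mapping.lookup P m) *
      mon_diff m (\<Sum>m'\<in>Poly_Mapping.keys Q. const (Poly_Mapping.lookup Q m') * mon_diff m' F))"
    by (simp add: mon_diff_sum mon_diff_const_mult mon_diff_add sum_distrib_left const_mult
        mult.assoc)
  finally show ?thesis
    unfolding diff_op_def .
qed

lemma poly_ring_simps [simp]:
  "mult (poly_ring N) = (*)" "one (poly_ring N) = 1"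
  "zero (poly_ring N) = 0" "add (poly_ring N) = (+)"
  by (simp_all add: poly_ring_def)

lemma carrier_poly_ring:
  "p \<in> carrier (poly_ring N) \<longleftrightarrow> (\<forall>m \<in> Poly_Mapping.keys p. Poly_Mapping.keys m \<subseteq> {1..N})"
  by (simp add: poly_ring_def)

lemma poly_ring_closed:
  assumes "p \<in> carrier (poly_ring N)" "q \<in> carrier (poly_ring N)"
  shows "p + q \<in> carrier (poly_ring N)" "p * q \<in> carrier (poly_ring N)"
    "- p \<in> carrier (poly_ring N)"
proof -
  show "p + q \<in> carrier (poly_ring N)"
    using assms Poly_Mapping.keys_add[of p q] unfolding carrier_poly_ring by blast
  show "p * q \<in> carrier (poly_ring N)"
    unfolding carrier_poly_ring
  proof
    fix m assume "m \<in> Poly_Mapping.keys (p * q)"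
    then obtain a b where ab: "m = a + b" "a \<in> Poly_Mapping.keys p" "b \<in> Poly_Mapping.keys q"
      using keys_mult[of p q] by blast
    with assms show "Poly_Mapping.keys m \<subseteq> {1..N}"
      using Poly_Mapping.keys_add[of a b] unfolding carrier_poly_ring by blast
  qed
  show "- p \<in> carrier (poly_ring N)"
    using assms by (simp add: carrier_poly_ring)
qed

lemma cring_poly_ring: "cring (poly_ring N)"
proof (rule cringI)
  show "abelian_group (poly_ring N)"
  proof (rule abelian_groupI)
    fix x assume "x \<in> carrier (poly_ring N)"
    then show "\<exists>y\<in>carrier (poly_ring N). y \<oplus>\<^bsub>poly_ring N\<^esub> x = \<zero>\<^bsub>poly_ring N\<^esub>"
      by (intro bexI[of _ "- x"]) (auto intro: poly_ring_closed)
  qed (auto simp: poly_ring_closed add_ac carrier_poly_ring[of 0])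
  show "comm_monoid (poly_ring N)"
    by (rule comm_monoidI) (auto simp: poly_ring_closed mult_ac carrier_poly_ring[of 1])
qed (auto simp: algebra_simps)

lemma ideal_Ann: "ideal (Ann N F) (poly_ring N)"
proof (rule idealI)
  show "ring (poly_ring N)"
    using cring_poly_ring by (rule cring.axioms(1))
  have minus: "\<ominus>\<^bsub>poly_ring N\<^esub> x = - x" if "x \<in> carrier (poly_ring N)" for x :: "'a mpoly"
  proof -
    interpret cring "poly_ring N :: 'a mpoly ring" by (rule cring_poly_ring)
    show ?thesis
      using minus_equality[of "- x" x] that poly_ring_closed(3)[OF that that] by simp
  qed
  show "subgroup (Ann N F) (add_monoid (poly_ring N))"
  proof
    fix x assume x: "x \<in> Ann N F"
    have "diff_op x F + diff_op (- x) F = 0"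
      by (simp flip: diff_op_add)
    then show "inv\<^bsub>add_monoid (poly_ring N)\<^esub> x \<in> Ann N F"
      using x minus[of x] by (auto simp: Ann_def a_inv_def intro: poly_ring_closed)
  qed (auto simp: Ann_def poly_ring_closed diff_op_add carrier_poly_ring[of 0])
next
  fix a x :: "'a mpoly"
  assume *: "a \<in> Ann N F" "x \<in> carrier (poly_ring N)"
  have "diff_op x (0::'a mpoly) = 0" for x
  proof -
    have "mon_diff m (0::'a mpoly) = 0" for m
      using mon_diff_sum[of m "\<lambda>_. 0" "{}"] by simp
    then show ?thesis by (simp add: diff_op_def)
  qed
  then have "x * a \<in> Ann N F"
    using * by (auto simp: Ann_def diff_op_mult poly_ring_closed)
  then show "x \<otimes>\<^bsub>poly_ring N\<^esub> a \<in> Ann N F" "a \<otimes>\<^bsub>poly_ring N\<^esub> x \<in> Ann N F"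
    by (simp_all add: mult.commute)
qed

end

theory Submission
  imports Defs
begin

text \<open>
  Let \<open>s = n - 1\<close> be the number of edges of a spanning tree and let \<open>L\<close> be the sum of the variables.
  Since \<open>F\<close> is squarefree, the coefficient of \<open>L ^ j (\<partial>) F\<close> at the squarefree monomial of an edge set
  \<open>R\<close> with \<open>s - j\<close> elements is \<open>j!\<close> times the number of spanning trees containing \<open>R\<close>. In degree 0 this
  number is the number of all spanning trees, and in the middle degree there is nothing to prove.
  As \<open>s \<le> 4\<close>, only degree 1 for \<open>n = 4, 5\<close> remains, where multiplication by \<open>L ^ (s - 2)\<close> is described
  by the matrix counting the spanning trees through two given edges \<open>e \<noteq> f\<close>. That count is
  proportional to \<open>4 - |e \<inter> f|\<close>, and this matrix is inverted explicitly: writing \<open>S\<close> for the sum of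
  all entries of a vector \<open>a\<close> and \<open>d v\<close> for the sum over the edges at \<open>v\<close>, it maps \<open>a\<close> to
  \<open>4 S - d u - d v - 2 a e\<close> at \<open>e = {u, v}\<close>, so that \<open>S\<close>, then \<open>d\<close>, then \<open>a\<close> can be recovered.
\<close>

section \<open>Homogeneous components of the quotient algebra\<close>

lemma diff_op_minus: "diff_op (P - Q) F = diff_op P F - diff_op Q F"
  by (metis diff_op_add add_diff_cancel_right' diff_add_cancel)

lemma minus_poly_ring:
  assumes "p \<in> carrier (poly_ring N)" "q \<in> carrier (poly_ring N)"
  shows "p \<ominus>\<^bsub>poly_ring N\<^esub> q = p - q"
proof -
  interpret cring "poly_ring N :: 'a mpoly ring" by (rule cring_poly_ring)
  have "\<ominus>\<^bsub>poly_ring N\<^esub> q = - q"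
    using minus_equality[of "- q" q] assms poly_ring_closed(3)[OF assms(2,2)] by simp
  then show ?thesis by (simp add: a_minus_def)
qed

text \<open>\<open>Ann N F\<close> is the kernel of the additive map taking \<open>P\<close> to
  \<open>diff_op P F\<close>, so from here on questions about cosets become questions about
  derivatives of \<open>F\<close>.\<close>

lemma quot_class_eq_iff:
  assumes "p \<in> carrier (poly_ring N)" "q \<in> carrier (poly_ring N)"
  shows "quot_class N F p = quot_class N F q \<longleftrightarrow> diff_op p F = diff_op q F"
proof -
  have "p - q \<in> carrier (poly_ring N)"
    using poly_ring_closed(1)[OF assms(1) poly_ring_closed(3)[OF assms(2,2)]] by simp
  then have "p - q \<in> Ann N F \<longleftrightarrow> diff_op p F = diff_op q F"
    by (simp add: Ann_def diff_op_minus)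
  then show ?thesis
    using ring.quotient_eq_iff_same_a_r_cos[OF cring.axioms(1)[OF cring_poly_ring] ideal_Ann assms]
    unfolding minus_poly_ring[OF assms] quot_class_def by blast
qed

lemma zero_quot_alg: "\<zero>\<^bsub>quot_alg N F\<^esub> = quot_class N F 0"
proof -
  interpret ideal "Ann N F" "poly_ring N" by (rule ideal_Ann)
  show ?thesis
    using a_rcos_zero[OF ideal_axioms, of 0] additive_subgroup.zero_closed[OF additive_subgroup_axioms]
    by (simp add: quot_alg_def FactRing_def quot_class_def)
qed

lemma quot_class_mult:
  assumes "p \<in> carrier (poly_ring N)" "q \<in> carrier (poly_ring N)"
  shows "quot_class N F p \<otimes>\<^bsub>quot_alg N F\<^esub> quot_class N F q = quot_class N F (p * q)"
proof -
  interpret ideal "Ann N F" "poly_ring N" by (rule ideal_Ann)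
  show ?thesis
    using rcoset_mult_add[OF assms] by (simp add: quot_alg_def FactRing_def quot_class_def)
qed

lemma one_in_poly_ring [simp]: "1 \<in> carrier (poly_ring N)"
  by (simp add: carrier_poly_ring)

lemma zero_in_poly_ring [simp]: "0 \<in> carrier (poly_ring N)"
  by (simp add: carrier_poly_ring)

lemma power_in_poly_ring: "p \<in> carrier (poly_ring N) \<Longrightarrow> p ^ j \<in> carrier (poly_ring N)"
  by (induction j) (auto intro: poly_ring_closed)

lemma quot_class_power:
  assumes "p \<in> carrier (poly_ring N)"
  shows "quot_class N F p [^]\<^bsub>quot_alg N F\<^esub> (j :: nat) = quot_class N F (p ^ j)"
proof (induction j)
  case 0
  show ?case
    by (simp add: quot_alg_def FactRing_def quot_class_def)
next
  case (Suc j)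
  then show ?case
    using assms by (simp add: quot_class_mult power_in_poly_ring mult.commute)
qed

lemma mdeg_add: "mdeg (a + b) = mdeg a + mdeg b"
proof -
  let ?S = "Poly_Mapping.keys a \<union> Poly_Mapping.keys b"
  have *: "mdeg m = (\<Sum>i\<in>?S. Poly_Mapping.lookup m i)" if "Poly_Mapping.keys m \<subseteq> ?S" for m
    unfolding mdeg_def using that by (intro sum.mono_neutral_left) (auto simp: in_keys_iff)
  show ?thesis
    using Poly_Mapping.keys_add[of a b] by (simp add: * lookup_add sum.distrib)
qed

lemma mdeg_0 [simp]: "mdeg 0 = 0"
  by (simp add: mdeg_def)

lemma mdeg_eq_0_iff: "mdeg m = 0 \<longleftrightarrow> m = 0"
  by (auto simp: mdeg_def in_keys_iff poly_mapping_eq_iff fun_eq_iff)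

lemma mdeg_single [simp]: "mdeg (Poly_Mapping.single i k) = k"
  by (simp add: mdeg_def)

lemma mdeg_eq_1E:
  assumes "mdeg m = 1"
  obtains i where "m = Poly_Mapping.single i 1"
proof -
  obtain i where i: "i \<in> Poly_Mapping.keys m"
    using assms by (force simp: mdeg_def)
  then have m: "m = Poly_Mapping.single i 1 + (m - Poly_Mapping.single i 1)"
    by (intro poly_mapping_eqI) (auto simp: lookup_add lookup_minus lookup_single when_def in_keys_iff)
  then have "mdeg (m - Poly_Mapping.single i 1) = 0"
    using assms mdeg_add[of "Poly_Mapping.single i 1" "m - Poly_Mapping.single i 1"] by simp
  with m have "m = Poly_Mapping.single i 1" by (simp add: mdeg_eq_0_iff)
  then show ?thesis by (rule that)
qed

lemma homogeneous_part_carrier: "p \<in> homogeneous_part N k \<Longrightarrow> p \<in> carrier (poly_ring N)"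
  by (simp add: homogeneous_part_def)

lemma homogeneous_partI:
  assumes "\<And>m. m \<in> Poly_Mapping.keys p \<Longrightarrow> Poly_Mapping.keys m \<subseteq> {1..N} \<and> mdeg m = k"
  shows "p \<in> homogeneous_part N k"
  using assms by (auto simp: homogeneous_part_def carrier_poly_ring)

lemma homogeneous_part_zero [simp]: "0 \<in> homogeneous_part N k"
  by (rule homogeneous_partI) simp

lemma homogeneous_part_add:
  assumes "p \<in> homogeneous_part N k" "q \<in> homogeneous_part N k"
  shows "p + q \<in> homogeneous_part N k"
  using assms Poly_Mapping.keys_add[of p q]
  by (auto simp: homogeneous_part_def poly_ring_closed(1))

lemma homogeneous_part_sum:
  "(\<And>x. x \<in> X \<Longrightarrow> f x \<in> homogeneous_part N k) \<Longrightarrow> sum f X \<in> homogeneous_part N k"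
  by (induction X rule: infinite_finite_induct) (auto intro: homogeneous_part_add)

lemma homogeneous_part_diff:
  assumes "p \<in> homogeneous_part N k" "q \<in> homogeneous_part N k"
  shows "p - q \<in> homogeneous_part N k"
proof -
  have "- q \<in> homogeneous_part N k"
    using assms(2) by (auto simp: homogeneous_part_def intro: poly_ring_closed)
  then show ?thesis
    using homogeneous_part_add[OF assms(1), of "- q"] by simp
qed

lemma homogeneous_part_mult:
  assumes "p \<in> homogeneous_part N k" "q \<in> homogeneous_part N l"
  shows "p * q \<in> homogeneous_part N (k + l)"
proof -
  have "mdeg m = k + l" if "m \<in> Poly_Mapping.keys (p * q)" for m
    using assms that keys_mult[of p q] by (force simp: homogeneous_part_def mdeg_add)
  then show ?thesis
    using assms by (auto simp: homogeneous_part_def intro: poly_ring_closed)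
qed

lemma homogeneous_part_power:
  assumes "p \<in> homogeneous_part N 1"
  shows "p ^ j \<in> homogeneous_part N j"
proof (induction j)
  case 0
  show ?case by (rule homogeneous_partI) simp
next
  case (Suc j)
  then show ?case using homogeneous_part_mult[OF assms Suc] by simp
qed

lemma homogeneous_part_single:
  assumes "Poly_Mapping.keys m \<subseteq> {1..N}"
  shows "Poly_Mapping.single m c \<in> homogeneous_part N (mdeg m)"
  using assms by (intro homogeneous_partI) (auto split: if_splits)

lemma homogeneous_part_degree_0:
  assumes "p \<in> homogeneous_part N 0"
  shows "p = const (Poly_Mapping.lookup p 0)"
proof (rule poly_mapping_eqI)
  fix m show "Poly_Mapping.lookup p m = Poly_Mapping.lookup (const (Poly_Mapping.lookup p 0)) m"
    using assms by (auto simp: homogeneous_part_def const_def lookup_single when_def mdeg_eq_0_iff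
        in_keys_iff)
qed

lemma homogeneous_part_degree_1:
  assumes "p \<in> homogeneous_part N 1"
  shows "p = (\<Sum>i = 1..N. const (Poly_Mapping.lookup p (Poly_Mapping.single i 1)) * var i)"
    (is "_ = ?R")
proof (rule poly_mapping_eqI)
  fix m
  have R: "Poly_Mapping.lookup ?R m =
    (\<Sum>i = 1..N. if m = Poly_Mapping.single i 1 then Poly_Mapping.lookup p m else 0)"
    unfolding lookup_sum lookup_const_mult var_def lookup_single
    by (intro sum.cong) (auto simp: when_def)
  show "Poly_Mapping.lookup p m = Poly_Mapping.lookup ?R m"
  proof (cases "m \<in> Poly_Mapping.keys p")
    case True
    then have "mdeg m = 1" "Poly_Mapping.keys m \<subseteq> {1..N}"
      using assms by (auto simp: homogeneous_part_def carrier_poly_ring)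
    moreover from this(1) obtain j where m: "m = Poly_Mapping.single j 1" by (rule mdeg_eq_1E)
    ultimately have "j \<in> {1..N}" by simp
    moreover have "Poly_Mapping.single j 1 = (Poly_Mapping.single i 1 :: monom) \<longleftrightarrow> i = j" for i
      by (metis lookup_single_eq lookup_single_not_eq zero_neq_one)
    ultimately show ?thesis unfolding R unfolding m by simp
  next
    case False
    then show ?thesis unfolding R by (auto simp: in_keys_iff intro!: sum.neutral)
  qed
qed

lemma homogeneous_part_degree_1_eqI:
  assumes "p \<in> homogeneous_part N 1" "q \<in> homogeneous_part N 1"
    and "\<And>i. i \<in> {1..N} \<Longrightarrow>
      Poly_Mapping.lookup p (Poly_Mapping.single i 1) = Poly_Mapping.lookup q (Poly_Mapping.single i 1)"
  shows "p = q"
proof -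
  have "(\<Sum>i = 1..N. const (Poly_Mapping.lookup p (Poly_Mapping.single i 1)) * var i) =
      (\<Sum>i = 1..N. const (Poly_Mapping.lookup q (Poly_Mapping.single i 1)) * var i)"
    by (intro sum.cong refl) (simp only: assms(3))
  then show ?thesis
    using homogeneous_part_degree_1[OF assms(1)] homogeneous_part_degree_1[OF assms(2)] by argo
qed

lemma lookup_diff_op:
  "Poly_Mapping.lookup (diff_op P F) a = (\<Sum>m\<in>Poly_Mapping.keys P.
    Poly_Mapping.lookup P m * Poly_Mapping.lookup (mon_diff m F) a)"
  by (simp add: diff_op_def lookup_sum lookup_const_mult)

text \<open>A monomial \<open>a\<close> can occur in the result only if \<open>a + m\<close> occurs
  in \<open>F\<close> for some monomial \<open>m\<close> of \<open>P\<close>, and degrees add. The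
  range \<open>s < k\<close> has its own clause because \<open>s - k\<close> is truncated to 0
  there.\<close>

lemma diff_op_homogeneous:
  assumes "P \<in> homogeneous_part N k" "F \<in> homogeneous_part N s"
  shows "diff_op P F \<in> homogeneous_part N (s - k)" "s < k \<Longrightarrow> diff_op P F = 0"
proof -
  have *: "Poly_Mapping.keys a \<subseteq> {1..N} \<and> mdeg a + k = s" if "a \<in> Poly_Mapping.keys (diff_op P F)" for a
  proof -
    from that have "Poly_Mapping.lookup (diff_op P F) a \<noteq> 0" by (simp add: in_keys_iff)
    then obtain m where m: "m \<in> Poly_Mapping.keys P" "Poly_Mapping.lookup (mon_diff m F) a \<noteq> 0"
      unfolding lookup_diff_op by (metis (mono_tags, lifting) mult_zero_right sum.neutral)
    from m(2) have "a + m \<in> Poly_Mapping.keys F"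
      by (auto simp: lookup_mon_diff[OF finite_keys order_refl] in_keys_iff)
    then have "mdeg (a + m) = s" "Poly_Mapping.keys (a + m) \<subseteq> {1..N}"
      using assms(2) by (auto simp: homogeneous_part_def carrier_poly_ring)
    moreover have "mdeg m = k"
      using assms(1) m(1) by (simp add: homogeneous_part_def)
    moreover have "Poly_Mapping.keys a \<subseteq> Poly_Mapping.keys (a + m)"
      by (auto simp: in_keys_iff lookup_add)
    ultimately show ?thesis by (auto simp: mdeg_add)
  qed
  then show "diff_op P F \<in> homogeneous_part N (s - k)"
    by (intro homogeneous_partI) force
  show "diff_op P F = 0" if "s < k"
    using * that by (intro poly_mapping_eqI) (fastforce simp: in_keys_iff)
qed

text \<open>By linearity, injectivity on classes reduces to a kernel contained in the annihilator,
  and surjectivity to finding a form with a prescribed derivative of \<open>F\<close>. Explicit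
  matrix computations will supply both.\<close>

lemma bij_betw_quot_part:
  fixes F L :: "'k::field_char_0 mpoly"
  assumes L: "L \<in> homogeneous_part N 1" and deg: "j + k = l"
    and inj: "\<And>p. p \<in> homogeneous_part N k \<Longrightarrow> diff_op (L ^ j * p) F = 0 \<Longrightarrow> diff_op p F = 0"
    and surj: "\<And>q. q \<in> homogeneous_part N l \<Longrightarrow>
      \<exists>p \<in> homogeneous_part N k. diff_op (L ^ j * p) F = diff_op q F"
  shows "bij_betw (\<lambda>a. (quot_class N F L [^]\<^bsub>quot_alg N F\<^esub> j) \<otimes>\<^bsub>quot_alg N F\<^esub> a)
    (quot_part N F k) (quot_part N F l)"
proof -
  let ?f = "\<lambda>a. (quot_class N F L [^]\<^bsub>quot_alg N F\<^esub> j) \<otimes>\<^bsub>quot_alg N F\<^esub> a"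
  have Lj: "L ^ j \<in> homogeneous_part N j" by (rule homogeneous_part_power[OF L])
  note car = homogeneous_part_carrier
  have f: "?f (quot_class N F p) = quot_class N F (L ^ j * p)" if "p \<in> homogeneous_part N k" for p
    using that L Lj by (simp add: quot_class_power[OF car[OF L]] quot_class_mult[OF car[OF Lj] car])
  have hom: "L ^ j * p \<in> homogeneous_part N l" if "p \<in> homogeneous_part N k" for p
    using homogeneous_part_mult[OF Lj that] deg by simp
  show ?thesis
    unfolding bij_betw_def
  proof
    show "inj_on ?f (quot_part N F k)"
    proof (rule inj_onI)
      fix a b assume "a \<in> quot_part N F k" "b \<in> quot_part N F k" and eq: "?f a = ?f b"
      then obtain p q where p: "p \<in> homogeneous_part N k" "a = quot_class N F p"
        and q: "q \<in> homogeneous_part N k" "b = quot_class N F q"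
        by (auto simp: quot_part_def)
      from eq have "diff_op (L ^ j * p) F = diff_op (L ^ j * q) F"
        using p q by (simp add: f quot_class_eq_iff[OF car[OF hom] car[OF hom]])
      then have "diff_op (L ^ j * (p - q)) F = 0"
        by (simp add: diff_op_minus right_diff_distrib)
      then have "diff_op (p - q) F = 0"
        by (rule inj[OF homogeneous_part_diff[OF p(1) q(1)]])
      then show "a = b"
        by (simp add: p(2) q(2) quot_class_eq_iff car[OF p(1)] car[OF q(1)] diff_op_minus)
    qed
    show "?f ` quot_part N F k = quot_part N F l"
    proof (intro equalityI subsetI)
      fix b assume "b \<in> ?f ` quot_part N F k"
      then show "b \<in> quot_part N F l"
        using f hom by (auto simp: quot_part_def)
    next
      fix b assume "b \<in> quot_part N F l"
      then obtain q where q: "q \<in> homogeneous_part N l" "b = quot_class N F q"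
        by (auto simp: quot_part_def)
      from surj[OF q(1)] obtain p where p: "p \<in> homogeneous_part N k"
        "diff_op (L ^ j * p) F = diff_op q F" by blast
      then have "b = ?f (quot_class N F p)"
        by (simp add: f q(2) quot_class_eq_iff[OF car[OF q(1)] car[OF hom[OF p(1)]]])
      then show "b \<in> ?f ` quot_part N F k"
        using p(1) by (auto simp: quot_part_def)
    qed
  qed
qed

section \<open>The sum of the variables and squarefree monomials\<close>

definition var_sum :: "nat \<Rightarrow> 'k::field_char_0 mpoly" where
  "var_sum N = (\<Sum>i = 1..N. var i)"

lemma var_in_homogeneous_part: "i \<in> {1..N} \<Longrightarrow> var i \<in> homogeneous_part N 1"
  unfolding var_def using homogeneous_part_single[of "Poly_Mapping.single i 1" N 1] by simp

lemma var_sum_in_homogeneous_part: "var_sum N \<in> homogeneous_part N 1"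
  unfolding var_sum_def by (intro homogeneous_part_sum var_in_homogeneous_part)

lemma lookup_diff_op_var:
  "Poly_Mapping.lookup (diff_op (var i) G) a =
    of_nat (Suc (Poly_Mapping.lookup a i)) * Poly_Mapping.lookup G (a + Poly_Mapping.single i 1)"
proof -
  have "mon_diff (Poly_Mapping.single i 1) G = pdiff i G"
    by (simp add: mon_diff_def)
  then show ?thesis
    by (simp add: var_def diff_op_single lookup_const_mult lookup_pdiff)
qed

lemma lookup_diff_op_var_sum:
  "Poly_Mapping.lookup (diff_op (var_sum N) G) a =
    (\<Sum>i = 1..N. of_nat (Suc (Poly_Mapping.lookup a i)) * Poly_Mapping.lookup G (a + Poly_Mapping.single i 1))"
  by (simp add: var_sum_def diff_op_sum lookup_sum lookup_diff_op_var)

lemma diff_op_const: "diff_op (const c) F = const c * F"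
  by (simp add: const_def diff_op_single mon_diff_def)

lemma diff_op_one [simp]: "diff_op 1 F = F"
  using diff_op_const[of 1 F] by (simp add: const_def)

definition ind_monom :: "nat set \<Rightarrow> monom" where
  "ind_monom S = (\<Sum>i\<in>S. Poly_Mapping.single i 1)"

lemma lookup_ind_monom: "finite S \<Longrightarrow> Poly_Mapping.lookup (ind_monom S) i = (if i \<in> S then 1 else 0)"
  by (simp add: ind_monom_def lookup_sum lookup_single when_def)

lemma keys_ind_monom: "finite S \<Longrightarrow> Poly_Mapping.keys (ind_monom S) = S"
  by (auto simp: in_keys_iff lookup_ind_monom split: if_splits)

lemma mdeg_ind_monom: "finite S \<Longrightarrow> mdeg (ind_monom S) = card S"
  by (simp add: mdeg_def keys_ind_monom lookup_ind_monom)

lemma ind_monom_eq_iff: "finite S \<Longrightarrow> finite R \<Longrightarrow> ind_monom S = ind_monom R \<longleftrightarrow> S = R"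
  by (metis keys_ind_monom)

lemma prod_var: "finite S \<Longrightarrow> (\<Prod>i\<in>S. var i) = Poly_Mapping.single (ind_monom S) 1"
  by (induction S rule: finite_induct) (auto simp: var_def ind_monom_def mult_single)

section \<open>Generating polynomials of families of sets of one size\<close>

text \<open>If \<open>B\<close> consists of the bases of a matroid, this is its basis generating
  polynomial; for spanning trees written as sets of labels it is the Kirchhoff polynomial.\<close>

definition set_poly :: "nat set set \<Rightarrow> 'k::field_char_0 mpoly" where
  "set_poly B = (\<Sum>S\<in>B. \<Prod>i\<in>S. var i)"

text \<open>The algebraic part treats spanning trees as sets of labels of one common size; graph
  theory enters it through the numbers \<open>cover R\<close>.\<close>

locale uniform_family =
  fixes N s :: nat and B :: "nat set set"
  assumes subset: "S \<in> B \<Longrightarrow> S \<subseteq> {1..N}"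
    and card_eq: "S \<in> B \<Longrightarrow> card S = s"
begin

lemma finite_members: "S \<in> B \<Longrightarrow> finite S"
  using subset finite_subset by blast

lemma finite_family: "finite B"
  by (rule finite_subset[of _ "Pow {1..N}"]) (use subset in auto)

lemma lookup_set_poly:
  "Poly_Mapping.lookup (set_poly B) a = (\<Sum>S\<in>B. if a = ind_monom S then 1 else 0)"
  unfolding set_poly_def lookup_sum
  by (intro sum.cong) (auto simp: prod_var finite_members lookup_single when_def)

lemma set_poly_homogeneous: "set_poly B \<in> homogeneous_part N s"
  unfolding set_poly_def
proof (rule homogeneous_part_sum)
  fix S assume S: "S \<in> B"
  then show "(\<Prod>i\<in>S. var i) \<in> homogeneous_part N s"
    using homogeneous_part_single[of "ind_monom S" N] subset[OF S] card_eq[OF S] finite_members[OF S]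
    by (simp add: prod_var keys_ind_monom mdeg_ind_monom)
qed

definition cover :: "nat set \<Rightarrow> nat" where
  "cover R = card {S \<in> B. R \<subseteq> S}"

text \<open>Derivatives of a squarefree polynomial are squarefree: a coefficient of the next
  derivative at \<open>a\<close> comes from coefficients at products of \<open>a\<close> with one
  variable, where the exponent of \<open>i\<close> is still at least 2.\<close>

lemma lookup_power_square:
  assumes "Poly_Mapping.lookup a i \<ge> 2"
  shows "Poly_Mapping.lookup (diff_op (var_sum N ^ j) (set_poly B :: 'k::field_char_0 mpoly)) a = 0"
  using assms
proof (induction j arbitrary: a)
  case 0
  have "a \<noteq> ind_monom S" if "S \<in> B" for S
    using 0 lookup_ind_monom[OF finite_members[OF that], of i] by (auto split: if_splits)
  then have "Poly_Mapping.lookup (set_poly B :: 'k mpoly) a = 0"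
    by (auto simp: lookup_set_poly intro: sum.neutral)
  then show ?case
    by simp
next
  case (Suc j)
  then show ?case
    by (simp add: diff_op_mult lookup_diff_op_var_sum lookup_add)
qed

text \<open>Each further derivative sums over the ways to add one label to \<open>R\<close>; labels
  already in \<open>R\<close> contribute nothing, by squarefreeness. A double count supplies the
  factor \<open>Suc j\<close> that turns \<open>fact j\<close> into
  \<open>fact (Suc j)\<close>.\<close>

lemma lookup_power_ind_monom:
  assumes "R \<subseteq> {1..N}" "card R + j = s"
  shows "Poly_Mapping.lookup (diff_op (var_sum N ^ j) (set_poly B)) (ind_monom R) =
    (fact j * of_nat (cover R) :: 'k::field_char_0)"
  using assms
proof (induction j arbitrary: R)
  case 0
  have fin: "finite R" using 0 finite_subset by blast
  have "Poly_Mapping.lookup (set_poly B :: 'k mpoly) (ind_monom R) =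
      (\<Sum>S\<in>B. if R \<subseteq> S then 1 else 0)"
    unfolding lookup_set_poly
  proof (rule sum.cong)
    fix S assume S: "S \<in> B"
    \<comment> \<open>Here \<open>card R = s\<close>, so inclusion in a member of size
      \<open>s\<close> is equality.\<close>
    have "R \<subseteq> S \<longleftrightarrow> R = S"
      using 0 card_eq[OF S] card_subset_eq[OF finite_members[OF S]] by auto
    then show "(if ind_monom R = ind_monom S then 1 else 0 :: 'k) = (if R \<subseteq> S then 1 else 0)"
      using ind_monom_eq_iff[OF fin finite_members[OF S]] by simp
  qed simp
  also have "\<dots> = of_nat (cover R)"
    using finite_family by (simp add: sum.If_cases cover_def Int_def)
  finally show ?case by simp
next
  case (Suc j)
  let ?G = "diff_op (var_sum N ^ j) (set_poly B) :: 'k mpoly"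
  have fin: "finite R" using Suc.prems finite_subset by blast
  have summand: "of_nat (Suc (Poly_Mapping.lookup (ind_monom R) i)) *
      Poly_Mapping.lookup ?G (ind_monom R + Poly_Mapping.single i 1) =
      (if i \<in> R then 0 else fact j * of_nat (cover (insert i R)))" if i: "i \<in> {1..N}" for i
  proof (cases "i \<in> R")
    case True
    then have "Poly_Mapping.lookup ?G (ind_monom R + Poly_Mapping.single i 1) = 0"
      using fin by (intro lookup_power_square[of _ i]) (simp add: lookup_add lookup_ind_monom)
    with True show ?thesis by simp
  next
    case False
    then have "ind_monom R + Poly_Mapping.single i 1 = ind_monom (insert i R)"
      using fin by (simp add: ind_monom_def add.commute)
    with False Suc.IH[of "insert i R"] Suc.prems i fin show ?thesis
      by (simp add: lookup_ind_monom)
  qed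
  \<comment> \<open>Double counting of the pairs of a label \<open>i\<close> outside
    \<open>R\<close> and a member \<open>S\<close> containing \<open>insert i R\<close>: each member
    containing \<open>R\<close> has exactly \<open>Suc j\<close> such labels.\<close>
  have "(\<Sum>i\<in>{1..N} - R. cover (insert i R)) = (\<Sum>i\<in>{1..N} - R. \<Sum>S\<in>{S \<in> B. R \<subseteq> S}. if i \<in> S then 1 else 0)"
    using finite_family by (intro sum.cong)
      (auto simp: cover_def sum.If_cases Int_def intro!: arg_cong[where f = card])
  also have "\<dots> = (\<Sum>S\<in>{S \<in> B. R \<subseteq> S}. \<Sum>i\<in>{1..N} - R. if i \<in> S then 1 else 0)"
    by (rule sum.swap)
  also have "\<dots> = (\<Sum>S\<in>{S \<in> B. R \<subseteq> S}. Suc j)"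
  proof (rule sum.cong)
    fix S assume S: "S \<in> {S \<in> B. R \<subseteq> S}"
    then have "({1..N} - R) \<inter> {i. i \<in> S} = S - R"
      using subset by auto
    moreover have "card (S - R) = Suc j"
      using S Suc.prems fin by (simp add: card_Diff_subset card_eq)
    ultimately show "(\<Sum>i\<in>{1..N} - R. if i \<in> S then 1 else 0) = Suc j"
      by (simp add: sum.If_cases)
  qed simp
  finally have count: "(\<Sum>i\<in>{1..N} - R. cover (insert i R)) = Suc j * cover R"
    by (simp add: cover_def)
  have "Poly_Mapping.lookup (diff_op (var_sum N ^ Suc j) (set_poly B :: 'k mpoly)) (ind_monom R) =
    (\<Sum>i = 1..N. of_nat (Suc (Poly_Mapping.lookup (ind_monom R) i)) *
      Poly_Mapping.lookup ?G (ind_monom R + Poly_Mapping.single i 1))"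
    by (simp add: diff_op_mult lookup_diff_op_var_sum)
  also have "\<dots> = (\<Sum>i = 1..N. if i \<in> R then 0 else fact j * of_nat (cover (insert i R)))"
    by (intro sum.cong refl summand)
  also have "\<dots> = (\<Sum>i\<in>{1..N} - R. fact j * of_nat (cover (insert i R)))"
    by (simp add: sum.If_cases Diff_eq)
  also have "\<dots> = fact j * of_nat (\<Sum>i\<in>{1..N} - R. cover (insert i R))"
    by (simp add: sum_distrib_left)
  also have "\<dots> = fact (Suc j) * of_nat (cover R)"
    unfolding count by (simp add: algebra_simps)
  finally show ?case .
qed

lemma lookup_power_zero:
  "Poly_Mapping.lookup (diff_op (var_sum N ^ s) (set_poly B)) 0 = (fact s * of_nat (card B) :: 'k::field_char_0)"
  using lookup_power_ind_monom[of "{}" s] by (simp add: ind_monom_def cover_def)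

text \<open>Up to \<open>fact (s - 2)\<close>, the map on linear forms is the Hessian matrix of the
  polynomial at the point with all coordinates 1: \<open>cover {i, j}\<close> off the diagonal, and
  0 on it by squarefreeness.\<close>

lemma lookup_power_linear_form:
  fixes a :: "nat \<Rightarrow> 'k::field_char_0"
  assumes j: "j \<in> {1..N}" and s: "s \<ge> 2"
  shows "Poly_Mapping.lookup
      (diff_op (var_sum N ^ (s - 2) * (\<Sum>i = 1..N. const (a i) * var i)) (set_poly B)) (Poly_Mapping.single j 1) =
    fact (s - 2) * (\<Sum>i\<in>{1..N} - {j}. a i * of_nat (cover {i, j}))"
proof -
  let ?G = "diff_op (var_sum N ^ (s - 2)) (set_poly B) :: 'k mpoly"
  have summand: "a i * (of_nat (Suc (Poly_Mapping.lookup (Poly_Mapping.single j 1) i)) *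
      Poly_Mapping.lookup ?G (Poly_Mapping.single j 1 + Poly_Mapping.single i 1)) =
      (if i = j then 0 else fact (s - 2) * (a i * of_nat (cover {i, j})))" if i: "i \<in> {1..N}" for i
  proof (cases "i = j")
    case True
    then have "Poly_Mapping.lookup ?G (Poly_Mapping.single j 1 + Poly_Mapping.single i 1) = 0"
      by (intro lookup_power_square[of _ i]) (simp add: lookup_add)
    with True show ?thesis by simp
  next
    case False
    then have "Poly_Mapping.single j 1 + Poly_Mapping.single i 1 = ind_monom {i, j}"
      by (simp add: ind_monom_def add.commute)
    moreover have "Poly_Mapping.lookup ?G (ind_monom {i, j}) = fact (s - 2) * of_nat (cover {i, j})"
      using i j s False by (intro lookup_power_ind_monom) auto
    ultimately show ?thesis
      using False by (simp add: lookup_single when_def)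
  qed
  have "Poly_Mapping.lookup
      (diff_op (var_sum N ^ (s - 2) * (\<Sum>i = 1..N. const (a i) * var i)) (set_poly B)) (Poly_Mapping.single j 1) =
    (\<Sum>i = 1..N. a i * (of_nat (Suc (Poly_Mapping.lookup (Poly_Mapping.single j 1) i)) *
      Poly_Mapping.lookup ?G (Poly_Mapping.single j 1 + Poly_Mapping.single i 1)))"
    by (subst mult.commute)
      (simp only: diff_op_mult diff_op_sum diff_op_const lookup_sum lookup_const_mult lookup_diff_op_var)
  also have "\<dots> = (\<Sum>i = 1..N. if i = j then 0 else fact (s - 2) * (a i * of_nat (cover {i, j})))"
    by (intro sum.cong refl summand)
  also have "\<dots> = (\<Sum>i\<in>{1..N} - {j}. if i = j then 0 else fact (s - 2) * (a i * of_nat (cover {i, j})))"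
    by (rule sum.mono_neutral_right) auto
  also have "\<dots> = (\<Sum>i\<in>{1..N} - {j}. fact (s - 2) * (a i * of_nat (cover {i, j})))"
    by (intro sum.cong) auto
  finally show ?thesis by (simp only: sum_distrib_left)
qed

section \<open>Lefschetz maps in degrees 0 and 1\<close>

text \<open>Differentiating \<open>F\<close> by a form of degree \<open>s\<close> leaves a constant,
  so both components are lines and the map is multiplication by one number.\<close>

lemma lefschetz_degree_0:
  fixes F :: "'k::field_char_0 mpoly"
  assumes "B \<noteq> {}" and F: "F = set_poly B"
  shows "bij_betw (\<lambda>a. (quot_class N F (var_sum N) [^]\<^bsub>quot_alg N F\<^esub> s) \<otimes>\<^bsub>quot_alg N F\<^esub> a)
    (quot_part N F 0) (quot_part N F s)"
proof (rule bij_betw_quot_part)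
  let ?L = "var_sum N :: 'k mpoly"
  have FN: "F \<in> homogeneous_part N s" unfolding F by (rule set_poly_homogeneous)
  have Ls: "?L ^ s \<in> homogeneous_part N s"
    by (rule homogeneous_part_power[OF var_sum_in_homogeneous_part])
  \<comment> \<open>The scale factor of the map: \<open>fact s\<close> times the number of members,
    nonzero because \<open>B\<close> is nonempty and the characteristic is 0.\<close>
  define t where "t = Poly_Mapping.lookup (diff_op (?L ^ s) F) 0"
  have t: "t \<noteq> 0"
    using assms finite_family by (simp add: t_def lookup_power_zero)
  have scale: "diff_op (?L ^ s * const c) F = const (c * t)" for c
  proof -
    have "diff_op (?L ^ s) F \<in> homogeneous_part N 0"
      using diff_op_homogeneous(1)[OF Ls FN] by simp
    then have "diff_op (?L ^ s) F = const t"
      unfolding t_def by (rule homogeneous_part_degree_0)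
    then show ?thesis
      by (simp add: mult.commute[of _ "const c"] diff_op_mult diff_op_const const_mult)
  qed
  have const_0: "const c = (0 :: 'k mpoly) \<longleftrightarrow> c = 0" for c
    unfolding const_def by (metis lookup_single_eq lookup_zero single_zero)
  show "?L \<in> homogeneous_part N 1" by (rule var_sum_in_homogeneous_part)
  show "s + 0 = s" by simp
  show "diff_op p F = 0" if "p \<in> homogeneous_part N 0" "diff_op (?L ^ s * p) F = 0" for p
  proof -
    have p: "p = const (Poly_Mapping.lookup p 0)" by (rule homogeneous_part_degree_0[OF that(1)])
    have "const (Poly_Mapping.lookup p 0 * t) = 0"
      using that(2) scale[of "Poly_Mapping.lookup p 0"] unfolding p[symmetric] by simp
    then have "Poly_Mapping.lookup p 0 = 0" using t by (simp add: const_0)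
    then have "p = 0" using p const_0 by metis
    then show ?thesis by simp
  qed
  show "\<exists>p\<in>homogeneous_part N 0. diff_op (?L ^ s * p) F = diff_op q F" if "q \<in> homogeneous_part N s" for q
  proof -
    let ?u = "Poly_Mapping.lookup (diff_op q F) 0"
    have "diff_op q F \<in> homogeneous_part N 0"
      using diff_op_homogeneous(1)[OF that FN] by simp
    then have "diff_op q F = const ?u" by (rule homogeneous_part_degree_0)
    then have "diff_op (?L ^ s * const (?u / t)) F = diff_op q F"
      using t by (simp add: scale)
    moreover have "const (?u / t) \<in> homogeneous_part N 0"
      unfolding const_def using homogeneous_part_single[of 0 N] by simp
    ultimately show ?thesis by blast
  qed
qed

text \<open>The class of a form \<open>q\<close> of degree \<open>s - 1\<close> is determined by the
  linear form \<open>diff_op q F\<close>, that is, by \<open>N\<close> coefficients. The map thereby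
  becomes the matrix of the numbers \<open>cover {i, j}\<close> with zero diagonal, whose
  injectivity and surjectivity are assumed here.\<close>

lemma lefschetz_degree_1:
  fixes F :: "'k::field_char_0 mpoly"
  assumes F: "F = set_poly B" and s: "s \<ge> 2"
    and inj: "\<And>(a :: nat \<Rightarrow> 'k) i. (\<And>j. j \<in> {1..N} \<Longrightarrow> (\<Sum>i\<in>{1..N} - {j}. a i * of_nat (cover {i, j})) = 0) \<Longrightarrow>
      i \<in> {1..N} \<Longrightarrow> a i = 0"
    and surj: "\<And>l :: nat \<Rightarrow> 'k. \<exists>a. \<forall>j\<in>{1..N}. (\<Sum>i\<in>{1..N} - {j}. a i * of_nat (cover {i, j})) = l j"
  shows "bij_betw (\<lambda>a. (quot_class N F (var_sum N) [^]\<^bsub>quot_alg N F\<^esub> (s - 2)) \<otimes>\<^bsub>quot_alg N F\<^esub> a)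
    (quot_part N F 1) (quot_part N F (s - 1))"
proof (rule bij_betw_quot_part)
  let ?L = "var_sum N :: 'k mpoly"
  have FN: "F \<in> homogeneous_part N s" unfolding F by (rule set_poly_homogeneous)
  show L: "?L \<in> homogeneous_part N 1" by (rule var_sum_in_homogeneous_part)
  show "s - 2 + 1 = s - 1" using s by simp
  show "diff_op p F = 0" if p: "p \<in> homogeneous_part N 1" and zero: "diff_op (?L ^ (s - 2) * p) F = 0" for p
  proof -
    let ?a = "\<lambda>i. Poly_Mapping.lookup p (Poly_Mapping.single i 1)"
    have peq: "p = (\<Sum>i = 1..N. const (?a i) * var i)" by (rule homogeneous_part_degree_1[OF p])
    have "(\<Sum>i\<in>{1..N} - {j}. ?a i * of_nat (cover {i, j})) = 0" if "j \<in> {1..N}" for j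
      using lookup_power_linear_form[OF that s, of ?a] zero unfolding peq[symmetric] F by simp
    then have "?a i = 0" if "i \<in> {1..N}" for i
      using inj[of ?a i] that by blast
    then have "p = 0"
      using p by (intro homogeneous_part_degree_1_eqI[of p N 0]) auto
    then show ?thesis by simp
  qed
  show "\<exists>p\<in>homogeneous_part N 1. diff_op (?L ^ (s - 2) * p) F = diff_op q F"
    if q: "q \<in> homogeneous_part N (s - 1)" for q
  proof -
    \<comment> \<open>Dividing the target by \<open>fact (s - 2)\<close> cancels the factor in
      \<open>lookup_power_linear_form\<close>.\<close>
    obtain a :: "nat \<Rightarrow> 'k" where a: "\<And>j. j \<in> {1..N} \<Longrightarrow> (\<Sum>i\<in>{1..N} - {j}. a i * of_nat (cover {i, j})) =
        Poly_Mapping.lookup (diff_op q F) (Poly_Mapping.single j 1) / fact (s - 2)"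
      using surj[of "\<lambda>j. Poly_Mapping.lookup (diff_op q F) (Poly_Mapping.single j 1) / fact (s - 2)"] by blast
    let ?p = "\<Sum>i = 1..N. const (a i) * var i"
    have "const (a i) * var i \<in> homogeneous_part N 1" if "i \<in> {1..N}" for i
      using homogeneous_part_mult[OF homogeneous_part_single[of 0 N "a i"] var_in_homogeneous_part[OF that]]
      by (simp add: const_def)
    then have p: "?p \<in> homogeneous_part N 1" by (rule homogeneous_part_sum)
    have "diff_op (?L ^ (s - 2) * ?p) F = diff_op q F"
    proof (rule homogeneous_part_degree_1_eqI)
      have "?L ^ (s - 2) * ?p \<in> homogeneous_part N (s - 1)"
        using homogeneous_part_mult[OF homogeneous_part_power[OF L] p, of "s - 2"] s
        by (simp add: Suc_diff_Suc numeral_2_eq_2)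
      from diff_op_homogeneous(1)[OF this FN] diff_op_homogeneous(1)[OF q FN]
      show "diff_op (?L ^ (s - 2) * ?p) F \<in> homogeneous_part N 1" "diff_op q F \<in> homogeneous_part N 1"
        using s by simp_all
      fix j assume j: "j \<in> {1..N}"
      show "Poly_Mapping.lookup (diff_op (?L ^ (s - 2) * ?p) F) (Poly_Mapping.single j 1) =
          Poly_Mapping.lookup (diff_op q F) (Poly_Mapping.single j 1)"
        using lookup_power_linear_form[OF j s, of a] unfolding a[OF j] F by simp
    qed
    with p show ?thesis by blast
  qed
qed

text \<open>The matrix conditions are guarded by \<open>s >= 3\<close>: for \<open>s = 2\<close>
  degree 1 is the middle degree, and for smaller \<open>s\<close> it lies above the middle.\<close>

lemma strong_Lefschetz_element_var_sum:
  fixes F :: "'k::field_char_0 mpoly"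
  assumes F: "F = set_poly B" and "B \<noteq> {}" and "s \<le> 4"
    and inj: "\<And>(a :: nat \<Rightarrow> 'k) i. s \<ge> 3 \<Longrightarrow>
      (\<And>j. j \<in> {1..N} \<Longrightarrow> (\<Sum>i\<in>{1..N} - {j}. a i * of_nat (cover {i, j})) = 0) \<Longrightarrow>
      i \<in> {1..N} \<Longrightarrow> a i = 0"
    and surj: "\<And>l :: nat \<Rightarrow> 'k. s \<ge> 3 \<Longrightarrow>
      \<exists>a. \<forall>j\<in>{1..N}. (\<Sum>i\<in>{1..N} - {j}. a i * of_nat (cover {i, j})) = l j"
  shows "strong_Lefschetz_element (quot_alg N F) (quot_part N F) (quot_class N F (var_sum N))"
  unfolding strong_Lefschetz_element_def
proof (intro conjI exI[of _ s] allI impI)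
  let ?L = "var_sum N :: 'k mpoly"
  have L: "?L \<in> homogeneous_part N 1" by (rule var_sum_in_homogeneous_part)
  have FN: "F \<in> homogeneous_part N s" unfolding F by (rule set_poly_homogeneous)
  show "quot_class N F ?L \<in> quot_part N F 1" using L by (auto simp: quot_part_def)
  \<comment> \<open>The class of \<open>?L ^ s\<close> witnesses that the component of degree
    \<open>s\<close> is nonzero.\<close>
  have "Poly_Mapping.lookup (diff_op (?L ^ s) F) 0 \<noteq> 0"
    using assms(2) finite_family by (simp add: F lookup_power_zero)
  then have "diff_op (?L ^ s) F \<noteq> diff_op 0 F" by auto
  then have "quot_class N F (?L ^ s) \<noteq> \<zero>\<^bsub>quot_alg N F\<^esub>"
    using quot_class_eq_iff[OF homogeneous_part_carrier[OF homogeneous_part_power[OF L]] zero_in_poly_ring]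
    unfolding zero_quot_alg by blast
  moreover have "quot_class N F (?L ^ s) \<in> quot_part N F s"
    using homogeneous_part_power[OF L] by (auto simp: quot_part_def)
  ultimately show "quot_part N F s \<noteq> {\<zero>\<^bsub>quot_alg N F\<^esub>}" by blast
  show "quot_part N F k = {\<zero>\<^bsub>quot_alg N F\<^esub>}" if "k > s" for k
  proof -
    have "quot_class N F p = quot_class N F 0" if p: "p \<in> homogeneous_part N k" for p
      using quot_class_eq_iff[OF homogeneous_part_carrier[OF p] zero_in_poly_ring, of F]
        diff_op_homogeneous(2)[OF p FN \<open>k > s\<close>] by simp
    moreover have "0 \<in> homogeneous_part N k" by simp
    ultimately show ?thesis unfolding zero_quot_alg quot_part_def by blast
  qed
  fix k assume k: "2 * k \<le> s"
  \<comment> \<open>Degree 2 requires \<open>s = 4\<close> and so falls under the middle case, in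
    which the exponent of \<open>?L\<close> is 0 and the map is the identity.\<close>
  then consider "2 * k = s" | "k = 0" | "k = 1" "s \<ge> 3" using \<open>s \<le> 4\<close> by linarith
  then show "bij_betw (\<lambda>a. (quot_class N F ?L [^]\<^bsub>quot_alg N F\<^esub> (s - 2 * k)) \<otimes>\<^bsub>quot_alg N F\<^esub> a)
      (quot_part N F k) (quot_part N F (s - k))"
  proof cases
    case 1
    then have "s - 2 * k = 0" "s - k = k" by auto
    then show ?thesis by (intro bij_betw_quot_part L) auto
  next
    case 2
    then show ?thesis using lefschetz_degree_0[OF assms(2) F] by simp
  next
    case 3
    then show ?thesis using lefschetz_degree_1[OF F] inj surj by simp
  qed
qed

end

section \<open>Spanning trees as connected graphs with one edge less than vertices\<close>

text \<open>A walk from a vertex of \<open>S\<close> to a vertex outside has a first edge that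
  leaves \<open>S\<close>.\<close>

lemma connected_graph_cut:
  assumes "connected_graph V E" "S \<subset> V" "S \<noteq> {}" "\<And>e. e \<in> E \<Longrightarrow> e \<subseteq> V"
  obtains u v where "u \<in> S" "v \<in> V - S" "{u, v} \<in> E"
proof -
  obtain u v where uv: "u \<in> S" "v \<in> V - S" using assms by auto
  have "(u, v) \<in> {(a, b). {a, b} \<in> E}\<^sup>*"
    using uv assms by (auto simp: connected_graph_def)
  then have "v \<in> S \<or> (\<exists>a\<in>S. \<exists>b\<in>V - S. {a, b} \<in> E)"
  proof induction
    case base
    then show ?case using uv by simp
  next
    case (step y z)
    then show ?case using assms(4)[of "{y, z}"] by auto
  qed
  with uv that show ?thesis by blast
qed

text \<open>Converse of the cut criterion: no edge leaves the set of vertices reachable from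
  \<open>u\<close>, so this set is all of \<open>V\<close>.\<close>

lemma connected_graphI_cut:
  assumes "V \<noteq> {}"
    and cut: "\<And>S. S \<subset> V \<Longrightarrow> S \<noteq> {} \<Longrightarrow> \<exists>u\<in>S. \<exists>v\<in>V - S. {u, v} \<in> E"
  shows "connected_graph V E"
  unfolding connected_graph_def
proof (intro conjI ballI assms(1))
  fix u v assume uv: "u \<in> V" "v \<in> V"
  let ?R = "{(a, b). {a, b} \<in> E}"
  let ?S = "{w \<in> V. (u, w) \<in> ?R\<^sup>*}"
  show "(u, v) \<in> ?R\<^sup>*"
  proof (rule ccontr)
    assume "(u, v) \<notin> ?R\<^sup>*"
    then have "?S \<subset> V" "u \<in> ?S" using uv by auto
    then obtain a b where ab: "a \<in> ?S" "b \<in> V - ?S" "{a, b} \<in> E"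
      using cut[of ?S] by blast
    then have "(u, b) \<in> ?R\<^sup>*"
      by (auto intro: rtrancl_into_rtrancl)
    with ab show False by auto
  qed
qed

text \<open>A tree is grown as in Prim's algorithm: each round attaches one new vertex by an edge
  leaving the vertices reached so far, which gives \<open>k\<close> edges on \<open>Suc k\<close>
  vertices.\<close>

lemma connected_graph_spanning_subset:
  assumes conn: "connected_graph V E" and "finite V" and sub: "\<And>e. e \<in> E \<Longrightarrow> e \<subseteq> V"
  obtains T where "T \<subseteq> E" "finite T" "connected_graph V T" "card T = card V - 1"
proof -
  have "k < card V \<Longrightarrow> \<exists>W T. W \<subseteq> V \<and> card W = Suc k \<and> T \<subseteq> E \<and> finite T \<and> card T = k \<and>
      (\<forall>e\<in>T. e \<subseteq> W) \<and> connected_graph W T" for k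
  proof (induction k)
    case 0
    obtain v where "v \<in> V" using conn by (auto simp: connected_graph_def)
    then show ?case
      by (intro exI[of _ "{v}"] exI[of _ "{}"]) (auto simp: connected_graph_def)
  next
    case (Suc k)
    then obtain W T where W: "W \<subseteq> V" "card W = Suc k" and T: "T \<subseteq> E" "finite T" "card T = k"
      "\<And>e. e \<in> T \<Longrightarrow> e \<subseteq> W" "connected_graph W T" by auto
    have "W \<subset> V" "W \<noteq> {}" using W Suc.prems by auto
    then obtain u v where uv: "u \<in> W" "v \<in> V - W" "{u, v} \<in> E"
      using connected_graph_cut[OF conn _ _ sub] by metis
    let ?W = "insert v W" and ?T = "insert {u, v} T"
    have "connected_graph ?W ?T"
    proof (rule connected_graphI_cut)
      fix S assume S: "S \<subset> ?W" "S \<noteq> {}"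
      \<comment> \<open>The side \<open>S\<close> is \<open>{v}\<close> or \<open>W\<close>, both
        crossed by the new edge, or it already cuts \<open>W\<close>.\<close>
      consider "S \<inter> W = {}" | "W \<subseteq> S" | "S \<inter> W \<subset> W" "S \<inter> W \<noteq> {}" by blast
      then show "\<exists>a\<in>S. \<exists>b\<in>?W - S. {a, b} \<in> ?T"
      proof cases
        case 1
        then have "v \<in> S" "u \<in> ?W - S" using S uv by auto
        then show ?thesis by (metis insertI1 insert_commute)
      next
        case 2
        then have "u \<in> S" "v \<in> ?W - S" using S uv by auto
        then show ?thesis by blast
      next
        case 3
        then obtain a b where "a \<in> S \<inter> W" "b \<in> W - S \<inter> W" "{a, b} \<in> T"
          using connected_graph_cut[OF T(5) _ _ T(4)] by metis
        then show ?thesis by blast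
      qed
    qed simp
    moreover have "{u, v} \<notin> T" using uv T(4) by auto
    moreover have "finite W" using W assms(2) finite_subset by blast
    ultimately show ?case
      using uv W T by (intro exI[of _ ?W] exI[of _ ?T]) (auto dest: T(4))
  qed
  moreover have "card V > 0"
    using conn assms(2) by (auto simp: connected_graph_def card_gt_0_iff)
  ultimately obtain W T where "W \<subseteq> V" "card W = card V" "T \<subseteq> E" "finite T" "card T = card V - 1"
      "connected_graph W T"
    by (metis Suc_pred lessI One_nat_def)
  then show ?thesis
    using that assms(2) card_subset_eq by metis
qed

lemma rtrancl_imp_simple_path:
  assumes "(u, v) \<in> R\<^sup>*"
  shows "\<exists>xs. xs \<noteq> [] \<and> distinct xs \<and> hd xs = u \<and> last xs = v \<and>
    (\<forall>i. Suc i < length xs \<longrightarrow> (xs ! i, xs ! Suc i) \<in> R)"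
  using assms
proof induction
  case base
  then show ?case by (intro exI[of _ "[u]"]) auto
next
  case (step y z)
  then obtain xs where xs: "xs \<noteq> []" "distinct xs" "hd xs = u" "last xs = y"
    "\<And>i. Suc i < length xs \<Longrightarrow> (xs ! i, xs ! Suc i) \<in> R" by blast
  show ?case
  proof (cases "z \<in> set xs")
    case True
    \<comment> \<open>A return to \<open>z\<close> closes a loop; the prefix ending at its earlier
      visit is still simple.\<close>
    then obtain k where "k < length xs" "xs ! k = z" by (auto simp: in_set_conv_nth)
    moreover from this have "last (take (Suc k) xs) = z"
      by (simp add: take_Suc_conv_app_nth)
    ultimately show ?thesis
      using xs by (intro exI[of _ "take (Suc k) xs"]) (simp add: hd_take)
  next
    case False
    have "((xs @ [z]) ! i, (xs @ [z]) ! Suc i) \<in> R" if "Suc i < length (xs @ [z])" for i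
    proof (cases "Suc i < length xs")
      case True
      then show ?thesis using xs(5)[of i] by (simp add: nth_append)
    next
      case False
      then have "i = length xs - 1" "Suc i = length xs" using that xs(1) by auto
      then show ?thesis
        using step.hyps(2) xs(1,4) by (simp add: nth_append last_conv_nth)
    qed
    with False xs show ?thesis
      by (intro exI[of _ "xs @ [z]"]) auto
  qed
qed

text \<open>A simple path from \<open>u\<close> to \<open>v\<close> in \<open>T\<close>, closed up
  by the edge \<open>{u, v}\<close>, would be a cycle. Its length is at least 3: one vertex would
  mean \<open>u = v\<close>, and two would put \<open>{u, v}\<close> into \<open>T\<close>.\<close>

lemma acyclic_imp_edge_bridge:
  assumes "\<not> (\<exists>c. is_cycle E c)" "{u, v} \<in> E" "u \<noteq> v" "T \<subseteq> E" "{u, v} \<notin> T"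
  shows "(u, v) \<notin> {(a, b). {a, b} \<in> T}\<^sup>*"
proof
  assume "(u, v) \<in> {(a, b). {a, b} \<in> T}\<^sup>*"
  then obtain c where c: "c \<noteq> []" "distinct c" "hd c = u" "last c = v"
    and edge: "\<And>i. Suc i < length c \<Longrightarrow> {c ! i, c ! Suc i} \<in> T"
    using rtrancl_imp_simple_path[of u v "{(a, b). {a, b} \<in> T}"] by auto
  have "length c \<noteq> 1" using c assms(3) by (auto simp: length_Suc_conv)
  moreover have "length c \<noteq> 2"
    using c assms(5) edge[of 0] by (auto simp: length_Suc_conv numeral_2_eq_2)
  moreover have "length c \<noteq> 0" using c(1) by simp
  ultimately have "length c \<ge> 3" by linarith
  moreover have "{c ! i, c ! (Suc i mod length c)} \<in> E" if "i < length c" for i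
  proof (cases "Suc i = length c")
    case True
    then have "c ! i = v" "c ! (Suc i mod length c) = u"
      using c by (auto simp: last_conv_nth hd_conv_nth simp flip: True)
    then show ?thesis using assms(2) by (simp add: insert_commute)
  next
    case False
    then show ?thesis using that edge[of i] assms(4) by auto
  qed
  ultimately have "is_cycle E c" using c by (auto simp: is_cycle_def)
  with assms(1) show False by blast
qed

text \<open>The closing edge of the cycle is dropped; any walk using it can take the rest of the
  cycle instead.\<close>

lemma cycle_remove_edge_connected:
  assumes "connected_graph V E" "is_cycle E c"
  obtains e where "e \<in> E" "connected_graph V (E - {e})"
proof
  let ?e = "{c ! (length c - 1), c ! 0}"
  let ?R = "{(a, b). {a, b} \<in> E - {?e}}"
  have c: "length c \<ge> 3" "distinct c"
    and edge: "\<And>i. i < length c \<Longrightarrow> {c ! i, c ! (Suc i mod length c)} \<in> E"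
    using assms(2) by (auto simp: is_cycle_def)
  show "?e \<in> E" using edge[of "length c - 1"] c(1) by (cases "length c") auto
  have path: "(c ! 0, c ! i) \<in> ?R\<^sup>*" if "i < length c" for i
    using that
  proof (induction i)
    case (Suc i)
    \<comment> \<open>The closing edge could reappear along the path only for \<open>i = 0\<close>
      in a cycle of length 2, which \<open>is_cycle\<close> excludes.\<close>
    have "{c ! i, c ! Suc i} \<noteq> ?e"
    proof
      assume "{c ! i, c ! Suc i} = ?e"
      then have "c ! i = c ! (length c - 1) \<or> c ! i = c ! 0 \<and> c ! Suc i = c ! (length c - 1)"
        unfolding doubleton_eq_iff by blast
      moreover have "c ! i = c ! (length c - 1) \<longleftrightarrow> i = length c - 1"
        by (rule nth_eq_iff_index_eq[OF c(2)]) (use Suc.prems in auto)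
      moreover have "c ! i = c ! 0 \<longleftrightarrow> i = 0"
        by (rule nth_eq_iff_index_eq[OF c(2)]) (use Suc.prems in auto)
      moreover have "c ! Suc i = c ! (length c - 1) \<longleftrightarrow> Suc i = length c - 1"
        by (rule nth_eq_iff_index_eq[OF c(2)]) (use Suc.prems in auto)
      ultimately show False using c(1) Suc.prems by linarith
    qed
    then have "(c ! i, c ! Suc i) \<in> ?R"
      using edge[of i] Suc.prems by simp
    with Suc show ?case by (auto intro: rtrancl_into_rtrancl)
  qed simp
  have "sym (?R\<^sup>*)"
    by (intro sym_rtrancl) (auto simp: sym_def insert_commute)
  moreover have ends: "(c ! 0, c ! (length c - 1)) \<in> ?R\<^sup>*"
    by (rule path) (use c(1) in linarith)
  ultimately have "(c ! (length c - 1), c ! 0) \<in> ?R\<^sup>*"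
    by (rule symD)
  with ends have "{(a, b). {a, b} \<in> E} \<subseteq> ?R\<^sup>*"
    by (auto simp: doubleton_eq_iff)
  then have "{(a, b). {a, b} \<in> E}\<^sup>* \<subseteq> ?R\<^sup>*"
    by (metis rtrancl_mono rtrancl_idemp)
  then show "connected_graph V (E - {?e})"
    using assms(1) by (auto simp: connected_graph_def)
qed

text \<open>Trading acyclicity for an edge count makes spanning trees accessible to enumeration. An
  acyclic \<open>E\<close> has no edge outside a connected spanning \<open>T\<close>, as such an
  edge would close a cycle; conversely, on a cycle an edge could be dropped, leaving too few edges
  to connect \<open>V\<close>.\<close>

lemma is_tree_iff_card:
  assumes V: "finite V" and E: "\<And>e. e \<in> E \<Longrightarrow> e \<subseteq> V \<and> card e = 2"
  shows "is_tree V E \<longleftrightarrow> connected_graph V E \<and> card E = card V - 1"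
proof -
  have sub: "\<And>e. e \<in> E \<Longrightarrow> e \<subseteq> V" using E by blast
  have finE: "finite E" by (rule finite_subset[of _ "Pow V"]) (use E V in auto)
  have "card E = card V - 1" if conn: "connected_graph V E" and acyc: "\<not> (\<exists>c. is_cycle E c)"
  proof -
    obtain T where T: "T \<subseteq> E" "connected_graph V T" "card T = card V - 1"
      using connected_graph_spanning_subset[OF conn V sub] by metis
    have "E \<subseteq> T"
    proof
      fix e assume e: "e \<in> E"
      then obtain u v where uv: "e = {u, v}" "u \<noteq> v" using E by (metis card_2_iff)
      have "u \<in> V" "v \<in> V" using sub[OF e] uv by auto
      then have "(u, v) \<in> {(a, b). {a, b} \<in> T}\<^sup>*"
        using T(2) by (simp add: connected_graph_def)
      then show "e \<in> T"
        using acyclic_imp_edge_bridge[OF acyc, of u v T] e uv T(1) by blast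
    qed
    with T show ?thesis by auto
  qed
  moreover have "\<not> is_cycle E c" if conn: "connected_graph V E" and card: "card E = card V - 1" for c
  proof
    assume "is_cycle E c"
    then obtain e where e: "e \<in> E" "connected_graph V (E - {e})"
      using cycle_remove_edge_connected[OF conn] by metis
    then obtain T where T: "T \<subseteq> E - {e}" "card T = card V - 1"
      using connected_graph_spanning_subset[OF e(2) V] sub by (metis DiffD1)
    have "card T \<le> card (E - {e})" using T(1) finE by (intro card_mono) auto
    also have "\<dots> < card E" using e(1) finE by (intro psubset_card_mono) auto
    finally show False using T(2) card by simp
  qed
  ultimately show ?thesis by (auto simp: is_tree_def)
qed

lemma finite_complete_edges: "finite (complete_edges n)"
  by (rule finite_subset[of _ "Pow {1..n}"]) (auto simp: complete_edges_def)

lemma spanning_trees_complete: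
  "spanning_trees {1..n} (complete_edges n) =
    {T. T \<subseteq> complete_edges n \<and> connected_graph {1..n} T \<and> card T = n - 1}"
proof -
  have "is_tree {1..n} T \<longleftrightarrow> connected_graph {1..n} T \<and> card T = n - 1" if "T \<subseteq> complete_edges n" for T
    using that is_tree_iff_card[of "{1..n}" T] by (auto simp: complete_edges_def)
  then show ?thesis by (auto simp: spanning_trees_def)
qed

lemma spanning_trees_complete_nonempty:
  assumes "n > 0"
  shows "spanning_trees {1..n} (complete_edges n) \<noteq> {}"
proof -
  have "connected_graph {1..n} (complete_edges n)"
  proof (rule connected_graphI_cut)
    fix S assume "S \<subset> {1..n}" "S \<noteq> {}"
    then obtain u v where "u \<in> S" "v \<in> {1..n} - S" by blast
    then show "\<exists>u\<in>S. \<exists>v\<in>{1..n} - S. {u, v} \<in> complete_edges n"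
      using \<open>S \<subset> {1..n}\<close> by (intro bexI[of _ u] bexI[of _ v]) (auto simp: complete_edges_def card_2_iff)
  qed (use assms in simp)
  then obtain T where "T \<subseteq> complete_edges n" "connected_graph {1..n} T" "card T = card {1..n} - 1"
    by (rule connected_graph_spanning_subset) (auto simp: complete_edges_def)
  then show ?thesis unfolding spanning_trees_complete by auto
qed

section \<open>The matrix of edge pairs\<close>

definition star_sum :: "nat \<Rightarrow> (nat set \<Rightarrow> 'k) \<Rightarrow> nat \<Rightarrow> 'k::field_char_0" where
  "star_sum n a v = (\<Sum>e | e \<in> complete_edges n \<and> v \<in> e. a e)"

lemma star_sum_eq_if:
  "star_sum n a v = (\<Sum>e\<in>complete_edges n. if v \<in> e then a e else 0)"
  using finite_complete_edges by (simp add: star_sum_def sum.If_cases Int_def)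

text \<open>Double counting of incidences. Taking \<open>X\<close> to be an edge produces the
  intersection sizes in \<open>pair_op\<close>, and taking all vertices gives a weighted handshake
  identity.\<close>

lemma sum_incidence:
  assumes "X \<subseteq> {1..n}"
  shows "(\<Sum>v\<in>X. star_sum n a v) = (\<Sum>e\<in>complete_edges n. of_nat (card (X \<inter> e)) * a e)"
proof -
  have fin: "finite X" using assms finite_subset by blast
  have "(\<Sum>v\<in>X. star_sum n a v) = (\<Sum>e\<in>complete_edges n. \<Sum>v\<in>X. if v \<in> e then a e else 0)"
    unfolding star_sum_eq_if by (rule sum.swap)
  also have "\<dots> = (\<Sum>e\<in>complete_edges n. of_nat (card (X \<inter> e)) * a e)"
    using fin by (intro sum.cong) (auto simp: sum.If_cases)
  finally show ?thesis .
qed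

lemma sum_star_sum: "(\<Sum>v = 1..n. star_sum n a v) = 2 * (\<Sum>e\<in>complete_edges n. a e)"
proof -
  have "{1..n} \<inter> e = e" "card e = 2" if "e \<in> complete_edges n" for e
    using that by (auto simp: complete_edges_def)
  then show ?thesis
    unfolding sum_incidence[OF order_refl] by (simp add: sum_distrib_left)
qed

text \<open>This is the signless Laplacian of the complete graph, \<open>(n - 2) I + J\<close> with
  \<open>J\<close> the all-ones matrix: \<open>v\<close> lies on \<open>n - 1\<close> edges, whose
  other ends run once through the other vertices.\<close>

lemma star_sum_vertex_sum:
  assumes v: "v \<in> {1..n}"
  shows "star_sum n (\<lambda>e. \<Sum>u\<in>e. d u) v = (of_nat n - 2) * d v + (\<Sum>u = 1..n. d u)"
proof -
  have "star_sum n (\<lambda>e. \<Sum>u\<in>e. d u) v = (\<Sum>w\<in>{1..n} - {v}. \<Sum>u\<in>{v, w}. d u)"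
    unfolding star_sum_def
  proof (rule sum.reindex_bij_betw[symmetric], rule bij_betwI')
    fix e assume "e \<in> {e \<in> complete_edges n. v \<in> e}"
    then show "\<exists>w\<in>{1..n} - {v}. e = {v, w}"
      by (auto simp: complete_edges_def card_2_iff)
  qed (use v in \<open>auto simp: complete_edges_def doubleton_eq_iff\<close>)
  also have "\<dots> = (\<Sum>w\<in>{1..n} - {v}. d v + d w)"
    by (intro sum.cong) auto
  also have "\<dots> = of_nat (n - 1) * d v + ((\<Sum>u = 1..n. d u) - d v)"
    using v by (simp add: sum.distrib sum_diff1)
  also have "\<dots> = (of_nat n - 2) * d v + (\<Sum>u = 1..n. d u)"
    using v by (simp add: of_nat_diff algebra_simps)
  finally show ?thesis .
qed

text \<open>The number of spanning trees of a complete graph that contain a given spanning forest is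
  a power of \<open>n\<close> times the product of the component sizes. For two edges this product
  is 3 if they are adjacent and 2 * 2 if they are disjoint, in both cases 4 minus the number of
  common vertices.\<close>

definition pair_op :: "nat \<Rightarrow> (nat set \<Rightarrow> 'k) \<Rightarrow> nat set \<Rightarrow> 'k::field_char_0" where
  "pair_op n a e = (\<Sum>f\<in>complete_edges n - {e}. (4 - of_nat (card (e \<inter> f))) * a f)"

text \<open>The matrix is 4 times the all-ones matrix minus the matrix of intersection sizes. The
  omitted diagonal entry would be \<open>4 - 2\<close>, hence the last term.\<close>

lemma pair_op_eq:
  assumes e: "e \<in> complete_edges n"
  shows "pair_op n a e = 4 * (\<Sum>f\<in>complete_edges n. a f) - (\<Sum>v\<in>e. star_sum n a v) - 2 * a e"
proof -
  have sub: "e \<subseteq> {1..n}" and card: "card e = 2" using e by (auto simp: complete_edges_def)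
  have "pair_op n a e = (\<Sum>f\<in>complete_edges n. (4 - of_nat (card (e \<inter> f))) * a f) - 2 * a e"
    unfolding pair_op_def using e finite_complete_edges card by (subst sum_diff1) auto
  also have "(\<Sum>f\<in>complete_edges n. (4 - of_nat (card (e \<inter> f))) * a f) =
      4 * (\<Sum>f\<in>complete_edges n. a f) - (\<Sum>v\<in>e. star_sum n a v)"
    by (simp add: sum_incidence[OF sub] left_diff_distrib sum_subtractf sum_distrib_left)
  finally show ?thesis .
qed

lemma star_sum_cong: "(\<And>e. e \<in> complete_edges n \<Longrightarrow> a e = b e) \<Longrightarrow> star_sum n a v = star_sum n b v"
  by (simp add: star_sum_def)

lemma star_sum_linear:
  "star_sum n (\<lambda>e. a e - b e) v = star_sum n a v - star_sum n b v"
  "star_sum n (\<lambda>e. x * a e) v = x * star_sum n a v"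
  by (simp_all add: star_sum_def sum_subtractf sum_distrib_left)

lemma star_sum_const:
  assumes "v \<in> {1..n}"
  shows "star_sum n (\<lambda>_. x) v = (of_nat n - 1) * x"
proof -
  \<comment> \<open>The constant \<open>x\<close> is the sum of \<open>x / 2\<close> over the two
    ends of an edge.\<close>
  have "star_sum n (\<lambda>_. x) v = star_sum n (\<lambda>e. \<Sum>u\<in>e. x / 2) v"
    by (rule star_sum_cong) (simp add: complete_edges_def)
  also have "\<dots> = (of_nat n - 2) * (x / 2) + (\<Sum>u = 1..n. x / 2)"
    by (rule star_sum_vertex_sum[OF assms])
  also have "\<dots> = (of_nat n - 1) * x"
    by (simp add: field_simps)
  finally show ?thesis .
qed

lemma pair_op_inj:
  fixes a :: "nat set \<Rightarrow> 'k::field_char_0"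
  assumes n: "n \<ge> 3" and zero: "\<And>e. e \<in> complete_edges n \<Longrightarrow> pair_op n a e = 0"
    and e: "e \<in> complete_edges n"
  shows "a e = 0"
proof -
  let ?S = "\<Sum>f\<in>complete_edges n. a f"
  \<comment> \<open>Star sums of \<open>pair_op_eq\<close> leave one equation per vertex, whose only
    unknowns are the star sum there and the total \<open>?S\<close>.\<close>
  have star: "of_nat n * star_sum n a v = (4 * of_nat n - 6) * ?S" if v: "v \<in> {1..n}" for v
  proof -
    have "0 = star_sum n (pair_op n a) v"
      by (simp add: star_sum_def zero)
    also have "\<dots> = star_sum n (\<lambda>e. 4 * ?S - (\<Sum>v\<in>e. star_sum n a v) - 2 * a e) v"
      by (rule star_sum_cong) (simp add: pair_op_eq)
    also have "\<dots> = (4 * of_nat n - 6) * ?S - of_nat n * star_sum n a v"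
      unfolding star_sum_linear star_sum_const[OF v] star_sum_vertex_sum[OF v] sum_star_sum
      by (simp add: algebra_simps)
    finally show ?thesis by simp
  qed
  \<comment> \<open>Summing the vertex equations isolates the total:
    \<open>(4 n - 8) ?S = 0\<close>, and the factor is nonzero for \<open>n >= 3\<close>.\<close>
  have "of_nat n * (2 * ?S) = (\<Sum>v = 1..n. of_nat n * star_sum n a v)"
    unfolding sum_distrib_left[symmetric] sum_star_sum ..
  also have "\<dots> = of_nat n * ((4 * of_nat n - 6) * ?S)"
    by (simp add: star)
  finally have "(of_nat n * 4 - of_nat 8) * ?S = 0"
    using n by (simp add: algebra_simps)
  moreover have "of_nat n * 4 - of_nat 8 \<noteq> (0 :: 'k)"
  proof -
    have "of_nat (n * 4) \<noteq> (of_nat 8 :: 'k)" using n unfolding of_nat_eq_iff by simp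
    then show ?thesis by simp
  qed
  ultimately have S: "?S = 0" by simp
  then have "star_sum n a v = 0" if "v \<in> {1..n}" for v
    using star[OF that] n by simp
  moreover have "e \<subseteq> {1..n}" using e by (simp add: complete_edges_def)
  ultimately have "(\<Sum>v\<in>e. star_sum n a v) = 0" by (intro sum.neutral) auto
  then show ?thesis using zero[OF e] pair_op_eq[OF e, of a] S by simp
qed

lemma pair_op_surj:
  fixes l :: "nat set \<Rightarrow> 'k::field_char_0"
  assumes n: "n \<ge> 3"
  obtains a where "\<And>e. e \<in> complete_edges n \<Longrightarrow> pair_op n a e = l e"
proof
  define x :: 'k where "x = of_nat n"
  have x: "x \<noteq> 0" "x - 2 \<noteq> 0"
  proof -
    show "x \<noteq> 0" using n by (simp add: x_def)
    have "of_nat n \<noteq> (of_nat 2 :: 'k)" using n unfolding of_nat_eq_iff by simp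
    then show "x - 2 \<noteq> 0" by (simp add: x_def)
  qed
  \<comment> \<open>The witness solves the equations of the injectivity proof backwards. The vertex
    equation is now \<open>star_sum n l v = (4 x - 6) S - x d v\<close>; summed over all vertices,
    with the \<open>d v\<close> adding up to \<open>2 S\<close>, it gives
    \<open>2 x (x - 2) S\<close> as the total of \<open>l\<close>. Then \<open>d\<close> comes from
    the vertex equation and \<open>a\<close> from \<open>pair_op_eq\<close>.\<close>
  define S where "S = (\<Sum>e\<in>complete_edges n. l e) / (2 * x * (x - 2))"
  define d where "d v = ((4 * x - 6) * S - star_sum n l v) / x" for v
  define a where "a e = (4 * S - (\<Sum>v\<in>e. d v) - l e) / 2" for e
  have L: "(\<Sum>e\<in>complete_edges n. l e) = 2 * x * (x - 2) * S"
    using x by (simp add: S_def)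
  \<comment> \<open>So far \<open>S\<close> and \<open>d\<close> are mere numbers; it remains to
    verify that they are the total and the star sums of \<open>a\<close>.\<close>
  have "(\<Sum>v = 1..n. d v) = (x * ((4 * x - 6) * S) - 2 * (2 * x * (x - 2) * S)) / x"
    unfolding d_def sum_divide_distrib[symmetric] sum_subtractf sum_star_sum L by (simp add: x_def)
  also have "\<dots> = 2 * S" using x(1) by (simp add: field_simps)
  finally have D: "(\<Sum>v = 1..n. d v) = 2 * S" .
  have star: "star_sum n a v = d v" if v: "v \<in> {1..n}" for v
  proof -
    have "star_sum n a v = star_sum n (\<lambda>e. (1 / 2) * (4 * S - (\<Sum>v\<in>e. d v) - l e)) v"
      by (rule star_sum_cong) (simp add: a_def)
    also have "\<dots> = (1 / 2) * ((x - 1) * (4 * S) - ((x - 2) * d v + 2 * S) - star_sum n l v)"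
      unfolding star_sum_linear star_sum_const[OF v] star_sum_vertex_sum[OF v] D x_def by simp
    also have "\<dots> = d v"
    proof -
      have "star_sum n l v = (4 * x - 6) * S - x * d v" using x(1) by (simp add: d_def)
      then show ?thesis by (simp add: field_simps)
    qed
    finally show ?thesis .
  qed
  have "2 * (\<Sum>e\<in>complete_edges n. a e) = 2 * S"
    unfolding sum_star_sum[symmetric] D[symmetric] by (intro sum.cong refl star)
  then have S: "(\<Sum>e\<in>complete_edges n. a e) = S" by simp
  fix e assume e: "e \<in> complete_edges n"
  have "(\<Sum>v\<in>e. star_sum n a v) = (\<Sum>v\<in>e. d v)"
    using e by (intro sum.cong refl star) (auto simp: complete_edges_def)
  then show "pair_op n a e = l e"
    unfolding pair_op_eq[OF e] S by (simp add: a_def field_simps)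
qed

section \<open>Counting the spanning trees through two edges\<close>

text \<open>
  Extending an accumulator one element at a time, instead of filtering the list of all subsets, keeps
  the terms small enough for the counts to be evaluated by rewriting.
\<close>

fun count_ext :: "('a list \<Rightarrow> bool) \<Rightarrow> nat \<Rightarrow> 'a list \<Rightarrow> 'a list \<Rightarrow> nat" where
  "count_ext P 0 xs acc = (if P acc then 1 else 0)"
| "count_ext P (Suc k) [] acc = 0"
| "count_ext P (Suc k) (x # xs) acc = count_ext P k xs (x # acc) + count_ext P (Suc k) xs acc"

text \<open>The subsets of size \<open>k\<close> are split by whether they contain the head
  \<open>x\<close>. Since \<open>P\<close> sees only the set of a list, the order of accumulation is
  immaterial.\<close>

lemma count_ext_eq_card:
  assumes PQ: "\<And>l. P l \<longleftrightarrow> Q (set l)" and "distinct xs"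
  shows "count_ext P k xs acc = card {X. X \<subseteq> set xs \<and> card X = k \<and> Q (X \<union> set acc)}"
  using assms(2)
proof (induction xs arbitrary: k acc)
  case Nil
  have "{X. X \<subseteq> {} \<and> card X = k \<and> Q (X \<union> set acc)} = (if k = 0 \<and> Q (set acc) then {{}} else {})"
    by auto
  then show ?case
    by (cases k) (auto simp: PQ)
next
  case (Cons x xs)
  show ?case
  proof (cases k)
    case 0
    have "{X. X \<subseteq> set (x # xs) \<and> card X = k \<and> Q (X \<union> set acc)} = (if Q (set acc) then {{}} else {})"
      using 0 finite_subset[of _ "set (x # xs)"] by auto
    then show ?thesis using 0 by (auto simp: PQ)
  next
    case (Suc j)
    let ?A = "{X. X \<subseteq> set xs \<and> card X = j \<and> Q (X \<union> set (x # acc))}"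
    let ?B = "{X. X \<subseteq> set xs \<and> card X = Suc j \<and> Q (X \<union> set acc)}"
    let ?C = "{X. X \<subseteq> set (x # xs) \<and> card X = Suc j \<and> Q (X \<union> set acc)}"
    have x: "x \<notin> set xs" using Cons.prems by simp
    have fin: "finite X" if "X \<subseteq> set xs" for X using that finite_subset by blast
    have "?C = insert x ` ?A \<union> ?B"
    proof (intro equalityI subsetI)
      fix X assume X: "X \<in> ?C"
      then have "finite X" using finite_subset[of X "set (x # xs)"] by auto
      show "X \<in> insert x ` ?A \<union> ?B"
      proof (cases "x \<in> X")
        case True
        then have "X = insert x (X - {x})" "X \<union> set acc = (X - {x}) \<union> set (x # acc)" by auto
        moreover have "card (X - {x}) = j" using True X \<open>finite X\<close> by simp
        moreover have "X - {x} \<subseteq> set xs" using X by auto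
        ultimately have "X - {x} \<in> ?A" using X by simp
        then show ?thesis using \<open>X = insert x (X - {x})\<close> by blast
      next
        case False
        then show ?thesis using X by auto
      qed
    next
      fix X assume "X \<in> insert x ` ?A \<union> ?B"
      then show "X \<in> ?C" using x fin by (auto simp: card_insert_if)
    qed
    moreover have "finite ?A" "finite ?B"
      by (rule finite_subset[of _ "Pow (set xs)"]; auto)+
    moreover have "insert x ` ?A \<inter> ?B = {}" using x by auto
    moreover have "inj_on (insert x) ?A"
      using x by (auto intro!: inj_onI simp: insert_ident subset_iff)
    ultimately have "card ?C = card ?A + card ?B"
      by (simp add: card_Un_disjoint card_image)
    then show ?thesis
      using Cons Suc by simp
  qed
qed

section \<open>Executable edges and cuts of the complete graph\<close>

text \<open>Putting the smaller vertex first gives every edge exactly one computable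
  representative.\<close>

definition edge_list :: "nat \<Rightarrow> (nat \<times> nat) list" where
  "edge_list n = [(i, j). i \<leftarrow> [1..<Suc n], j \<leftarrow> [Suc i..<Suc n]]"

definition edge :: "nat \<times> nat \<Rightarrow> nat set" where
  "edge p = {fst p, snd p}"

text \<open>A cut of \<open>{1..n}\<close> is represented by its side containing the vertex 1.\<close>

definition cut_list :: "nat \<Rightarrow> nat list list" where
  "cut_list n = map ((#) 1) (filter (\<lambda>S. length S < n - 1) (subseqs [2..<Suc n]))"

definition crosses :: "(nat \<times> nat) list \<Rightarrow> nat list \<Rightarrow> bool" where
  "crosses l S \<longleftrightarrow> list_ex (\<lambda>p. List.member S (fst p) \<noteq> List.member S (snd p)) l"

text \<open>\<open>k\<close> is the number of edges still to be chosen, and \<open>a\<close> and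
  \<open>b\<close> are the expected counts for adjacent and for disjoint pairs. Connectedness is
  tested by the crossing of every cut in \<open>cs\<close>.\<close>

definition check_counts :: "nat \<Rightarrow> nat \<Rightarrow> nat \<Rightarrow> nat list list \<Rightarrow> (nat \<times> nat) list \<Rightarrow> bool" where
  "check_counts k a b cs es \<longleftrightarrow>
    list_all (\<lambda>p. list_all (\<lambda>q. p = q \<or>
      count_ext (\<lambda>l. list_all (crosses l) cs) k (filter (\<lambda>r. r \<noteq> p \<and> r \<noteq> q) es) [p, q] =
        (if fst p = fst q \<or> fst p = snd q \<or> snd p = fst q \<or> snd p = snd q then a else b)) es) es"

lemma set_edge_list: "set (edge_list n) = {p. 1 \<le> fst p \<and> fst p < snd p \<and> snd p \<le> n}"
  by (force simp: edge_list_def)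

lemma distinct_edge_list: "distinct (edge_list n)"
  unfolding edge_list_def
  by (auto simp: distinct_concat_iff distinct_map inj_on_def removeAll_filter_not_eq)

lemma inj_on_edge: "inj_on edge (set (edge_list n))"
  by (auto simp: inj_on_def edge_def set_edge_list doubleton_eq_iff prod_eq_iff)

lemma image_edge_list: "edge ` set (edge_list n) = complete_edges n"
proof (intro equalityI subsetI)
  fix e assume "e \<in> complete_edges n"
  then obtain u v where uv: "e = {u, v}" "u \<noteq> v" "u \<in> {1..n}" "v \<in> {1..n}"
    by (auto simp: complete_edges_def card_2_iff)
  then have "e = edge (min u v, max u v)" "(min u v, max u v) \<in> set (edge_list n)"
    by (auto simp: edge_def set_edge_list min_def max_def)
  then show "e \<in> edge ` set (edge_list n)" by blast
qed (auto simp: edge_def set_edge_list complete_edges_def)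

definition crossed_cuts :: "nat \<Rightarrow> (nat \<times> nat) set \<Rightarrow> bool" where
  "crossed_cuts n Y \<longleftrightarrow> (\<forall>S. 1 \<in> S \<and> S \<subset> {1..n} \<longrightarrow> (\<exists>p\<in>Y. (fst p \<in> S) \<noteq> (snd p \<in> S)))"

text \<open>The length bound in \<open>cut_list\<close> removes just the sublist of all vertices
  from 2 to \<open>n\<close>, whose side would be the whole vertex set.\<close>

lemma set_cut_list:
  assumes "n > 0"
  shows "set ` set (cut_list n) = {S. 1 \<in> S \<and> S \<subset> {1..n}}"
proof (intro equalityI subsetI)
  fix S assume "S \<in> set ` set (cut_list n)"
  then obtain l where l: "l \<in> set (subseqs [2..<Suc n])" "length l < n - 1" "S = insert 1 (set l)"
    by (auto simp: cut_list_def)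
  have "set l \<subseteq> {2..n}"
  proof -
    have "set l \<in> set ` set (subseqs [2..<Suc n])" using l(1) by blast
    then show ?thesis unfolding subseqs_powset by auto
  qed
  moreover have "card S < n"
    using l(2,3) card_length[of l] assms by (auto simp: card_insert_if)
  then have "S \<noteq> {1..n}" by auto
  ultimately show "S \<in> {S. 1 \<in> S \<and> S \<subset> {1..n}}"
    using l(3) assms by auto
next
  fix S assume "S \<in> {S. 1 \<in> S \<and> S \<subset> {1..n}}"
  then have S: "1 \<in> S" "S \<subset> {1..n}" by auto
  have "S - {1} \<in> Pow (set [2..<Suc n])"
  proof (intro PowI subsetI)
    fix x assume "x \<in> S - {1}"
    then have "x \<in> {1..n}" "x \<noteq> 1" using S by auto
    then show "x \<in> set [2..<Suc n]" by (simp only: set_upt atLeastAtMost_iff atLeastLessThan_iff) linarith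
  qed
  then obtain l where l: "l \<in> set (subseqs [2..<Suc n])" "set l = S - {1}"
    unfolding subseqs_powset[symmetric] by auto
  have "card S < n" using psubset_card_mono[OF _ S(2)] by simp
  moreover have "finite S" by (rule finite_subset[of _ "{1..n}"]) (use S(2) in auto)
  moreover have "distinct l" using subseqs_distinctD[OF l(1)] by simp
  then have "length l = card (S - {1})" using l(2) distinct_card by metis
  moreover have "card (S - {1}) = card S - 1" using S(1) by simp
  moreover have "card S > 0" using S(1) \<open>finite S\<close> card_gt_0_iff by blast
  ultimately have "length l < n - 1" by linarith
  then have "1 # l \<in> set (cut_list n)" using l(1) by (simp add: cut_list_def)
  moreover have "set (1 # l) = S" using l(2) S(1) by auto
  ultimately show "S \<in> set ` set (cut_list n)" by blast
qed

lemma list_all_crosses: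
  assumes "n > 0"
  shows "list_all (crosses l) (cut_list n) \<longleftrightarrow> crossed_cuts n (set l)"
proof -
  have "list_all (crosses l) (cut_list n) \<longleftrightarrow>
      (\<forall>S \<in> set ` set (cut_list n). \<exists>p\<in>set l. (fst p \<in> S) \<noteq> (snd p \<in> S))"
    by (auto simp: list_all_iff crosses_def list_ex_iff)
  then show ?thesis
    unfolding set_cut_list[OF assms] crossed_cuts_def by auto
qed

text \<open>An edge crosses a set exactly when it crosses the complement, so a side avoiding the
  vertex 1 is replaced by its complement.\<close>

lemma crossed_cuts_iff_connected:
  assumes n: "n > 0" and Y: "Y \<subseteq> set (edge_list n)"
  shows "crossed_cuts n Y \<longleftrightarrow> connected_graph {1..n} (edge ` Y)"
proof
  have sub: "e \<subseteq> {1..n}" if "e \<in> edge ` Y" for e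
    using that Y image_edge_list[of n] by (auto simp: complete_edges_def)
  {
    assume "connected_graph {1..n} (edge ` Y)"
    show "crossed_cuts n Y"
      unfolding crossed_cuts_def
    proof (intro allI impI)
      fix S assume S: "1 \<in> S \<and> S \<subset> {1..n}"
      then obtain u v where "u \<in> S" "v \<in> {1..n} - S" "{u, v} \<in> edge ` Y"
        using connected_graph_cut[OF \<open>connected_graph {1..n} (edge ` Y)\<close> _ _ sub] by blast
      then show "\<exists>p\<in>Y. (fst p \<in> S) \<noteq> (snd p \<in> S)"
        by (force simp: edge_def doubleton_eq_iff)
    qed
  next
    assume cc: "crossed_cuts n Y"
    have cross: "\<exists>u\<in>S. \<exists>v\<in>{1..n} - S. {u, v} \<in> edge ` Y" if S: "1 \<in> S" "S \<subset> {1..n}" for S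
    proof -
      obtain p where p: "p \<in> Y" "(fst p \<in> S) \<noteq> (snd p \<in> S)"
        using cc S unfolding crossed_cuts_def by blast
      have "{fst p, snd p} \<in> edge ` Y" "{snd p, fst p} \<in> edge ` Y"
        using p(1) by (auto simp: edge_def insert_commute)
      moreover have "fst p \<in> {1..n}" "snd p \<in> {1..n}"
        using p(1) Y by (auto simp: set_edge_list)
      ultimately show ?thesis
        using p(2) by (cases "fst p \<in> S") blast+
    qed
    show "connected_graph {1..n} (edge ` Y)"
    proof (rule connected_graphI_cut)
      fix S assume S: "S \<subset> {1..n}" "S \<noteq> {}"
      show "\<exists>u\<in>S. \<exists>v\<in>{1..n} - S. {u, v} \<in> edge ` Y"
      proof (cases "1 \<in> S")
        case True
        with S cross show ?thesis by blast
      next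
        case False
        then have "1 \<in> {1..n} - S" "{1..n} - S \<subset> {1..n}" using S n by auto
        then have "\<exists>u\<in>{1..n} - S. \<exists>v\<in>{1..n} - ({1..n} - S). {u, v} \<in> edge ` Y"
          by (rule cross)
        moreover have "{1..n} - ({1..n} - S) = S" using S by auto
        ultimately show ?thesis by (metis insert_commute)
      qed
    qed (use n in simp)
  }
qed

text \<open>A tree through both edges is determined by its other \<open>n - 3\<close> edges, and an
  edge set of the right size is a tree exactly when it crosses every cut.\<close>

lemma card_spanning_trees_pair:
  assumes n: "n \<ge> 3" and pq: "p \<in> set (edge_list n)" "q \<in> set (edge_list n)" "p \<noteq> q"
  shows "card {T \<in> spanning_trees {1..n} (complete_edges n). edge p \<in> T \<and> edge q \<in> T} =
    count_ext (\<lambda>l. list_all (crosses l) (cut_list n)) (n - 3)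
      (filter (\<lambda>r. r \<noteq> p \<and> r \<noteq> q) (edge_list n)) [p, q]"
proof -
  let ?es = "set (edge_list n)"
  let ?A = "{X. X \<subseteq> ?es - {p, q} \<and> card X = n - 3 \<and> crossed_cuts n (X \<union> {p, q})}"
  let ?f = "\<lambda>X. edge ` (X \<union> {p, q})"
  have "bij_betw ?f ?A {T \<in> spanning_trees {1..n} (complete_edges n). edge p \<in> T \<and> edge q \<in> T}"
    (is "bij_betw _ _ ?T")
  proof (rule bij_betw_imageI)
    show "inj_on ?f ?A"
    proof (rule inj_onI)
      fix X X' assume X: "X \<in> ?A" "X' \<in> ?A" "?f X = ?f X'"
      then have "X \<union> {p, q} = X' \<union> {p, q}"
        using pq by (intro inj_on_image_eq_iff[OF inj_on_edge, THEN iffD1]) auto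
      then show "X = X'" using X by blast
    qed
    have card: "card (?f X) = card X + 2" if "X \<subseteq> ?es - {p, q}" for X
    proof -
      have "finite X" using that finite_subset by blast
      moreover have "card (?f X) = card (X \<union> {p, q})"
        using that pq by (intro card_image inj_on_subset[OF inj_on_edge]) auto
      moreover have "X \<inter> {p, q} = {}" using that by blast
      ultimately show ?thesis using pq(3) by (simp add: card_Un_disjoint)
    qed
    show "?f ` ?A = ?T"
    proof (intro equalityI subsetI)
      fix T assume "T \<in> ?f ` ?A"
      then obtain X where X: "X \<in> ?A" "T = ?f X" by blast
      have "X \<union> {p, q} \<subseteq> ?es" using X pq by auto
      moreover from this have "T \<subseteq> complete_edges n"
        unfolding X(2) image_edge_list[symmetric] by (rule image_mono)
      ultimately show "T \<in> ?T"
        unfolding spanning_trees_complete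
        using X n card[of X] crossed_cuts_iff_connected[of n "X \<union> {p, q}"] by auto
    next
      fix T assume T: "T \<in> ?T"
      let ?Y = "{r \<in> ?es. edge r \<in> T}"
      have "T \<subseteq> edge ` ?es"
        using T unfolding spanning_trees_complete image_edge_list by blast
      then have TY: "T = edge ` ?Y" by blast
      have Y: "?Y = (?Y - {p, q}) \<union> {p, q}" using pq T by auto
      then have eq: "T = ?f (?Y - {p, q})" using TY by simp
      have "card (?Y - {p, q}) = n - 3"
      proof -
        have "card T = n - 1" using T unfolding spanning_trees_complete by blast
        moreover have "card T = card (?Y - {p, q}) + 2"
          unfolding eq[symmetric] by (subst eq) (rule card, blast)
        ultimately show ?thesis using n by linarith
      qed
      moreover have "crossed_cuts n ?Y"
        using crossed_cuts_iff_connected[of n ?Y] T n unfolding TY[symmetric] spanning_trees_complete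
        by auto
      ultimately have "?Y - {p, q} \<in> ?A" using Y by auto
      then show "T \<in> ?f ` ?A" using eq by blast
    qed
  qed
  then have "card ?T = card ?A"
    by (rule bij_betw_same_card[symmetric])
  also have "\<dots> = card {X. X \<subseteq> set (filter (\<lambda>r. r \<noteq> p \<and> r \<noteq> q) (edge_list n)) \<and> card X = n - 3 \<and>
      crossed_cuts n (X \<union> set [p, q])}"
  proof -
    have "set (filter (\<lambda>r. r \<noteq> p \<and> r \<noteq> q) (edge_list n)) = ?es - {p, q}" by auto
    then show ?thesis unfolding list.set by (rule ssubst) (rule refl)
  qed
  also have "\<dots> = count_ext (\<lambda>l. list_all (crosses l) (cut_list n)) (n - 3)
      (filter (\<lambda>r. r \<noteq> p \<and> r \<noteq> q) (edge_list n)) [p, q]"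
    by (rule count_ext_eq_card[symmetric])
      (use n list_all_crosses[of n] distinct_edge_list[of n] in simp_all)
  finally show ?thesis .
qed

text \<open>Two distinct edges share at most one vertex, so \<open>3 * c\<close> and
  \<open>4 * c\<close> are the only values to be checked.\<close>

lemma check_counts_imp_card:
  assumes n: "n \<ge> 3" and check: "check_counts (n - 3) (3 * c) (4 * c) (cut_list n) (edge_list n)"
    and ef: "e \<in> complete_edges n" "f \<in> complete_edges n" "e \<noteq> f"
  shows "card {T \<in> spanning_trees {1..n} (complete_edges n). e \<in> T \<and> f \<in> T} = (4 - card (e \<inter> f)) * c"
proof -
  obtain p q where p: "p \<in> set (edge_list n)" "e = edge p" and q: "q \<in> set (edge_list n)" "f = edge q"
    using ef unfolding image_edge_list[symmetric] by blast
  have "p \<noteq> q" using ef p q by auto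
  then have "card (e \<inter> f) =
      (if fst p = fst q \<or> fst p = snd q \<or> snd p = fst q \<or> snd p = snd q then 1 else 0)"
    using p q by (auto simp: edge_def set_edge_list prod_eq_iff Int_insert_left)
  moreover have "card {T \<in> spanning_trees {1..n} (complete_edges n). e \<in> T \<and> f \<in> T} =
      (if fst p = fst q \<or> fst p = snd q \<or> snd p = fst q \<or> snd p = snd q then 3 * c else 4 * c)"
    using check[unfolded check_counts_def list_all_iff[of _ "edge_list n"], THEN bspec, OF p(1),
        THEN bspec, OF q(1)] \<open>p \<noteq> q\<close> card_spanning_trees_pair[OF n p(1) q(1) \<open>p \<noteq> q\<close>]
    unfolding p(2) q(2) by (simp only: simp_thms)
  ultimately show ?thesis by auto
qed

text \<open>The forest count predicts \<open>c = n ^ (n - 4)\<close>, that is 1 for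
  \<open>n = 4\<close> and 5 for \<open>n = 5\<close>, hence the pairs 3, 4 and 15, 20. Both cases
  are confirmed by exhaustive enumeration.\<close>

lemma card_spanning_trees_pair_4_5:
  assumes "n \<in> {4, 5}"
  obtains c where "c > 0" "\<And>e f. e \<in> complete_edges n \<Longrightarrow> f \<in> complete_edges n \<Longrightarrow> e \<noteq> f \<Longrightarrow>
    card {T \<in> spanning_trees {1..n} (complete_edges n). e \<in> T \<and> f \<in> T} = (4 - card (e \<inter> f)) * c"
proof -
  have 4: "check_counts 1 3 4 (cut_list 4) (edge_list 4)"
    by code_simp
  have 5: "check_counts 2 15 20 (cut_list 5) (edge_list 5)"
    by code_simp
  from assms consider "n = 4" | "n = 5" by auto
  then show ?thesis
  proof cases
    case 1
    then show ?thesis using 4 check_counts_imp_card[of n 1] by (intro that[of 1]) auto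
  next
    case 2
    then show ?thesis using 5 check_counts_imp_card[of n 5] by (intro that[of 5]) auto
  qed
qed

section \<open>Transfer from edges to labels\<close>

theorem theorem4p5:
  fixes n N :: nat
    and lab :: "nat set \<Rightarrow> nat"
    and F :: "'k::field_char_0 mpoly"
  assumes "0 < n" and "n \<le> 5"
    and "N = card (complete_edges n)"
    and "bij_betw lab (complete_edges n) {1..N}"
    and "F = Kirchhoff_poly {1..n} (complete_edges n) lab"
  shows "strong_Lefschetz_property (quot_alg N F) (quot_part N F) \<and>
    strong_Lefschetz_element (quot_alg N F) (quot_part N F) (quot_class N F (\<Sum>i = 1..N. var i))"
proof -
  let ?E = "complete_edges n"
  define TT where "TT = spanning_trees {1..n} (complete_edges n)"
  \<comment> \<open>Trees become sets of labels. As \<open>lab\<close> is injective on edges,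
    different trees stay different and no two monomials of the Kirchhoff polynomial merge.\<close>
  define B where "B = (`) lab ` TT"
  have inj: "inj_on lab ?E" and im: "lab ` ?E = {1..N}"
    using assms(4) by (auto simp: bij_betw_def)
  have T: "T \<subseteq> ?E" "card T = n - 1" if "T \<in> TT" for T
    using that unfolding TT_def spanning_trees_complete by auto
  have inj_T: "inj_on lab T" if "T \<in> TT" for T
    using inj T(1)[OF that] by (rule inj_on_subset)
  have inj_image: "inj_on ((`) lab) TT"
    by (rule inj_onI) (simp add: inj_on_image_eq_iff[OF inj T(1) T(1)])
  interpret uniform_family N "n - 1" B
  proof
    fix S assume "S \<in> B"
    then obtain R where R: "R \<in> TT" "S = lab ` R" by (auto simp: B_def)
    show "S \<subseteq> {1..N}" using T(1)[OF R(1)] R(2) im by blast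
    show "card S = n - 1" using T(2)[OF R(1)] card_image[OF inj_T[OF R(1)]] R(2) by simp
  qed
  have F: "F = set_poly B"
  proof -
    have "set_poly B = (\<Sum>R\<in>TT. \<Prod>i\<in>lab ` R. var i :: 'k mpoly)"
      unfolding set_poly_def B_def by (simp add: sum.reindex[OF inj_image])
    also have "\<dots> = (\<Sum>R\<in>TT. \<Prod>e\<in>R. var (lab e))"
      by (intro sum.cong refl) (simp add: prod.reindex[OF inj_T])
    finally show ?thesis unfolding assms(5) Kirchhoff_poly_def TT_def by simp
  qed
  have "B \<noteq> {}" using spanning_trees_complete_nonempty[OF assms(1)] by (simp add: B_def TT_def)
  have cover: "cover {lab e, lab f} = card {R \<in> TT. e \<in> R \<and> f \<in> R}" if ef: "e \<in> ?E" "f \<in> ?E" for e f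
  proof -
    have mem: "lab g \<in> lab ` R \<longleftrightarrow> g \<in> R" if "R \<in> TT" "g \<in> ?E" for R g
      using inj_on_image_mem_iff[OF inj that(2) T(1)[OF that(1)]] .
    have "{S \<in> B. {lab e, lab f} \<subseteq> S} = (`) lab ` {R \<in> TT. e \<in> R \<and> f \<in> R}"
      using mem ef by (auto simp: B_def)
    moreover have "inj_on ((`) lab) {R \<in> TT. e \<in> R \<and> f \<in> R}"
      using inj_image by (rule inj_on_subset) auto
    ultimately show ?thesis unfolding cover_def by (simp add: card_image)
  qed
  \<comment> \<open>The factor \<open>c\<close> is the constant of the tree count, nonzero in
    characteristic 0, so injectivity and surjectivity pass from \<open>pair_op\<close> to the matrix
    of cover numbers.\<close>
  have hessian: "\<exists>c\<noteq>0. \<forall>(a :: nat \<Rightarrow> 'k). \<forall>e\<in>?E. (\<Sum>i\<in>{1..N} - {lab e}. a i * of_nat (cover {i, lab e})) =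
      c * pair_op n (a \<circ> lab) e" if "n - 1 \<ge> 3"
  proof -
    from that have "n \<in> {4, 5}" using assms(2) by auto
    then obtain c where c: "c > 0" and count: "\<And>e f. e \<in> ?E \<Longrightarrow> f \<in> ?E \<Longrightarrow> e \<noteq> f \<Longrightarrow>
        card {R \<in> TT. e \<in> R \<and> f \<in> R} = (4 - card (e \<inter> f)) * c"
      unfolding TT_def by (rule card_spanning_trees_pair_4_5) blast
    have "(\<Sum>i\<in>{1..N} - {lab e}. a i * of_nat (cover {i, lab e})) = of_nat c * pair_op n (a \<circ> lab) e"
      if e: "e \<in> ?E" for a :: "nat \<Rightarrow> 'k" and e
    proof -
      have "{1..N} - {lab e} = lab ` (?E - {e})"
        using inj_on_image_set_diff[OF inj, of ?E "{e}"] e im by auto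
      then have "(\<Sum>i\<in>{1..N} - {lab e}. a i * of_nat (cover {i, lab e})) =
          (\<Sum>f\<in>?E - {e}. a (lab f) * of_nat (cover {lab f, lab e}))"
        using inj_on_subset[OF inj, of "?E - {e}"] by (simp add: sum.reindex)
      also have "\<dots> = (\<Sum>f\<in>?E - {e}. of_nat c * ((4 - of_nat (card (e \<inter> f))) * (a \<circ> lab) f))"
      proof (intro sum.cong refl)
        fix f assume f: "f \<in> ?E - {e}"
        have "finite e" "card e = 2"
          using e by (auto simp: complete_edges_def intro: finite_subset)
        \<comment> \<open>With this bound the truncated subtraction of natural numbers becomes
          subtraction in the field.\<close>
        then have "card (e \<inter> f) \<le> 4" using card_mono[of e "e \<inter> f"] by auto
        moreover have "cover {lab f, lab e} = (4 - card (e \<inter> f)) * c"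
          using cover[of f e] count[of f e] e f by (auto simp: Int_commute)
        ultimately show "a (lab f) * of_nat (cover {lab f, lab e}) =
            of_nat c * ((4 - of_nat (card (e \<inter> f))) * (a \<circ> lab) f)"
          by (simp add: of_nat_diff)
      qed
      finally show ?thesis by (simp only: pair_op_def sum_distrib_left)
    qed
    then show ?thesis using c by (intro exI[of _ "of_nat c"]) auto
  qed
  have "strong_Lefschetz_element (quot_alg N F) (quot_part N F) (quot_class N F (var_sum N))"
  proof (rule strong_Lefschetz_element_var_sum[OF F \<open>B \<noteq> {}\<close>])
    show "n - 1 \<le> 4" using assms(2) by simp
  next
    fix a :: "nat \<Rightarrow> 'k" and i
    assume n: "n - 1 \<ge> 3" and i: "i \<in> {1..N}"
      and zero: "\<And>j. j \<in> {1..N} \<Longrightarrow> (\<Sum>i\<in>{1..N} - {j}. a i * of_nat (cover {i, j})) = 0"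
    from hessian[OF n] obtain c :: 'k where c: "c \<noteq> 0"
      "\<And>e. e \<in> ?E \<Longrightarrow> (\<Sum>i\<in>{1..N} - {lab e}. a i * of_nat (cover {i, lab e})) = c * pair_op n (a \<circ> lab) e"
      by blast
    have "pair_op n (a \<circ> lab) e = 0" if "e \<in> ?E" for e
    proof -
      have "lab e \<in> {1..N}" using that im by blast
      then show ?thesis using zero[of "lab e"] c(1) c(2)[OF that] by simp
    qed
    moreover obtain e where "e \<in> ?E" "i = lab e" using i im by blast
    ultimately show "a i = 0" using pair_op_inj[of n "a \<circ> lab" e] n by auto
  next
    fix l :: "nat \<Rightarrow> 'k"
    assume n: "n - 1 \<ge> 3"
    from hessian[OF n] obtain c :: 'k where c: "c \<noteq> 0"
      "\<And>a e. e \<in> ?E \<Longrightarrow> (\<Sum>i\<in>{1..N} - {lab e}. a i * of_nat (cover {i, lab e})) = c * pair_op n (a \<circ> lab) e"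
      by blast
    obtain b where b: "\<And>e. e \<in> ?E \<Longrightarrow> pair_op n b e = l (lab e) / c"
      by (rule pair_op_surj[of n "\<lambda>e. l (lab e) / c"]) (use n in auto)
    \<comment> \<open>The solution found on edges is carried over to labels by the inverse of
      \<open>lab\<close>.\<close>
    define a where "a = b \<circ> inv_into ?E lab"
    have "pair_op n (a \<circ> lab) e = pair_op n b e" for e
      unfolding pair_op_def a_def using inj by (intro sum.cong) auto
    then have "(\<Sum>i\<in>{1..N} - {lab e}. a i * of_nat (cover {i, lab e})) = l (lab e)" if "e \<in> ?E" for e
      unfolding c(2)[OF that] using b[OF that] c(1) by simp
    then show "\<exists>a. \<forall>j\<in>{1..N}. (\<Sum>i\<in>{1..N} - {j}. a i * of_nat (cover {i, j})) = l j"
      unfolding im[symmetric] by (intro exI[of _ a]) blast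
  qed
  then show ?thesis
    unfolding strong_Lefschetz_property_def var_sum_def by blast
qed

end
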